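(* Let $T_{\mathbf m}$ be the $\mathbf m$-adic rooted tree of a sequence $\mathbf m=\{m_i\}_{i\ge 0}$ of natural numbers, let $G\le \mathrm{Aut}\,T_{\mathbf m}$ be a closed and level-transitive subgroup, and let $\mathcal N$ be a nice filtration of $G$ such that the rigid level stabilizers of $G$ are fully dimensional with respect to $\mathcal N$, i.e. $\mathrm{hdim}^{\mathcal N}_G(\mathrm{Rist}_G(n))=1$ for all $n\ge 1$. Then $$\mathrm{hspec}^{\mathcal N}(G)=[0,1].$$
   Context: The $\mathbf m$-adic tree $T_{\mathbf m}$ is the infinite rooted tree in which each vertex at distance $i$ from the root has exactly $m_i$ immediate descendants; the $n$th level $\mathcal L_n$ is the set of the $N_n=\prod_{i=0}^{n-1}m_i$ vertices at distance $n$ from the root. $\mathrm{Aut}\,T_{\mathbf m}$ is the group of graph automorphisms fixing the root, with the profinite (congruence) topology given by the level stabilizers $\mathrm{St}(n)$ (the pointwise stabilizer of $\mathcal L_n$). $G\le\mathrm{Aut}\,T_{\mathbf m}$ is level-transitive if it acts transitively on every $\mathcal L_n$. For a vertex $v$, $\mathrm{rist}_G(v)$ is the subgroup of elements of $G$ fixing $v$ and acting non-trivially only on the subtree rooted at $v$; $\mathrm{Rist}_G(n)$ is the (direct) product of the $\mathrm{rist}_G(v)$, $v\in\mathcal L_n$. A filtration of a closed subgroup $G$ is a descending chain $\{G_i\}_{i\ge 0}$ of open normal subgroups of $G$, $G_0=G$, with trivial intersection. It is a nice filtration if for every $k\ge 1$ there is an isomorphism $$\frac{\mathrm{Rist}_G(k)G_i}{G_i}\cong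 \frac{\mathrm{rist}_G(v_1)G_i}{G_i}\times\cdots\times\frac{\mathrm{rist}_G(v_{N_k})G_i}{G_i}$$ for all but finitely many $i$, where $v_1,\dots,v_{N_k}$ are the vertices of $\mathcal L_k$. For a closed subgroup $H\le G$ and a filtration $\mathcal N=\{G_i\}$ of $G$, the Hausdorff dimension is $$\mathrm{hdim}_G^{\mathcal N}(H)=\liminf_{i\to\infty}\frac{\log|HG_i:G_i|}{\log|G:G_i|},$$ and $\mathrm{hspec}^{\mathcal N}(G)=\{\mathrm{hdim}_G^{\mathcal N}(H)\mid H\le G\text{ closed}\}$. *)

theory Defs
  imports
    "HOL-Analysis.Analysis"
    "HOL-Library.Sublist"
    "HOL-Algebra.Bij"
    "HOL-Algebra.Product_Groups"
begin

text \<open>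
  A vertex is encoded by the path leading to it from the root \<open>[]\<close>: the immediate descendants
  of \<open>v\<close> are the \<open>v @ [x]\<close> with \<open>x < m (length v)\<close>. The distance of \<open>v\<close> from the root is
  \<open>length v\<close>, and the subtree rooted at \<open>v\<close> consists of the vertices of which \<open>v\<close> is a prefix.
\<close>

definition tree_verts :: "(nat \<Rightarrow> nat) \<Rightarrow> nat list set" where
  "tree_verts m = {v. \<forall>i<length v. v ! i < m i}"

definition tree_adj :: "nat list \<Rightarrow> nat list \<Rightarrow> bool" where
  "tree_adj u v \<longleftrightarrow> (\<exists>x. v = u @ [x]) \<or> (\<exists>x. u = v @ [x])"

definition tree_level :: "(nat \<Rightarrow> nat) \<Rightarrow> nat \<Rightarrow> nat list set" where
  "tree_level m n = {v \<in> tree_verts m. length v = n}"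

definition tree_aut :: "(nat \<Rightarrow> nat) \<Rightarrow> (nat list \<Rightarrow> nat list) set" where
  "tree_aut m = {f \<in> Bij (tree_verts m). f [] = [] \<and>
     (\<forall>u\<in>tree_verts m. \<forall>v\<in>tree_verts m. tree_adj (f u) (f v) \<longleftrightarrow> tree_adj u v)}"

definition Aut_tree :: "(nat \<Rightarrow> nat) \<Rightarrow> (nat list \<Rightarrow> nat list) monoid" where
  "Aut_tree m = (BijGroup (tree_verts m))\<lparr>carrier := tree_aut m\<rparr>"

lemma carrier_Aut_tree [simp]: "carrier (Aut_tree m) = tree_aut m"
  by (simp add: Aut_tree_def)

lemma Nil_in_tree_verts [simp]: "[] \<in> tree_verts m"
  by (simp add: tree_verts_def)

lemma subgroup_tree_aut: "subgroup (tree_aut m) (BijGroup (tree_verts m))"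
proof -
  interpret B: group "BijGroup (tree_verts m)" by (rule group_BijGroup)
  let ?V = "tree_verts m"
  show ?thesis
  proof (rule B.subgroupI)
    show "tree_aut m \<subseteq> carrier (BijGroup ?V)"
      by (auto simp: tree_aut_def BijGroup_def)
    have "(\<lambda>x\<in>?V. x) \<in> tree_aut m"
      by (auto simp: tree_aut_def id_Bij)
    then show "tree_aut m \<noteq> {}" by blast
  next
    fix f assume f: "f \<in> tree_aut m"
    then have fB: "f \<in> Bij ?V" by (simp add: tree_aut_def)
    then have bij: "bij_betw f ?V ?V" by (simp add: Bij_def)
    let ?g = "\<lambda>x\<in>?V. inv_into ?V f x"
    have g: "?g u \<in> ?V" "f (?g u) = u" if "u \<in> ?V" for u
      using that bij bij_betw_inv_into_right[OF bij, of u] Bij_inv_into_mem[OF fB, of u] by auto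
    have "inv_into ?V f [] = []"
      using bij f bij_betw_inv_into_left[OF bij, of "[]"] by (simp add: tree_aut_def)
    moreover have "tree_adj (?g u) (?g v) \<longleftrightarrow> tree_adj u v" if "u \<in> ?V" "v \<in> ?V" for u v
    proof -
      have "tree_adj (f (?g u)) (f (?g v)) \<longleftrightarrow> tree_adj (?g u) (?g v)"
        using f g(1)[OF that(1)] g(1)[OF that(2)] unfolding tree_aut_def by blast
      then show ?thesis by (simp only: g(2)[OF that(1)] g(2)[OF that(2)])
    qed
    ultimately have "?g \<in> tree_aut m"
      unfolding tree_aut_def using restrict_inv_into_Bij[OF fB] by simp
    moreover have "inv\<^bsub>BijGroup ?V\<^esub> f = ?g"
      using fB by (rule inv_BijGroup)
    ultimately show "inv\<^bsub>BijGroup ?V\<^esub> f \<in> tree_aut m" by simp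
  next
    fix f g assume fg: "f \<in> tree_aut m" "g \<in> tree_aut m"
    then have B: "f \<in> Bij ?V" "g \<in> Bij ?V" by (auto simp: tree_aut_def)
    have "g v \<in> ?V" if "v \<in> ?V" for v
      using Bij_imp_funcset[OF B(2)] that by auto
    then have "compose ?V f g \<in> tree_aut m"
      using fg compose_Bij[OF B] by (auto simp: tree_aut_def compose_def)
    then show "f \<otimes>\<^bsub>BijGroup ?V\<^esub> g \<in> tree_aut m"
      using B by (simp add: BijGroup_def)
  qed
qed

lemma group_Aut_tree: "group (Aut_tree m)"
  unfolding Aut_tree_def
  by (rule subgroup.subgroup_is_group[OF subgroup_tree_aut group_BijGroup])

lemma tree_aut_child:
  assumes f: "f \<in> tree_aut m" and v: "v @ [x] \<in> tree_verts m"
  shows "\<exists>y. f (v @ [x]) = f v @ [y]"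
  using v
proof (induction v arbitrary: x rule: rev_induct)
  case Nil
  then have "[x] \<in> tree_verts m" by simp
  moreover have "tree_adj [] [x]" by (simp add: tree_adj_def)
  ultimately have "tree_adj (f []) (f [x])"
    using f Nil_in_tree_verts[of m] unfolding tree_aut_def by blast
  then show ?case using f by (auto simp: tree_aut_def tree_adj_def)
next
  case (snoc z w)
  have parent: "u \<in> tree_verts m" if "u @ [a] \<in> tree_verts m" for u a
    unfolding tree_verts_def
  proof (intro CollectI allI impI)
    fix i assume "i < length u"
    moreover from this have "(u @ [a]) ! i < m i"
      using that by (simp add: tree_verts_def)
    ultimately show "u ! i < m i" by (simp add: nth_append)
  qed
  have wz: "w @ [z] \<in> tree_verts m" using parent[OF snoc.prems] .
  have w: "w \<in> tree_verts m" using parent[OF wz] .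
  obtain y where y: "f (w @ [z]) = f w @ [y]" using snoc.IH[OF wz] by blast
  have "tree_adj (w @ [z]) ((w @ [z]) @ [x])" by (simp add: tree_adj_def)
  then have "tree_adj (f (w @ [z])) (f ((w @ [z]) @ [x]))"
    using f wz snoc.prems unfolding tree_aut_def by blast
  moreover have "f ((w @ [z]) @ [x]) \<noteq> f w"
  proof
    assume "f ((w @ [z]) @ [x]) = f w"
    moreover have "inj_on f (tree_verts m)"
      using f by (auto simp: tree_aut_def Bij_def bij_betw_def)
    ultimately have "(w @ [z]) @ [x] = w" using snoc.prems w by (meson inj_onD)
    then show False by simp
  qed
  ultimately show ?case using y by (auto simp: tree_adj_def)
qed

definition level_stab :: "(nat \<Rightarrow> nat) \<Rightarrow> nat \<Rightarrow> (nat list \<Rightarrow> nat list) set" where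
  "level_stab m n = {g \<in> tree_aut m. \<forall>v\<in>tree_level m n. g v = v}"

lemma level_stab_antimono:
  assumes "k \<le> n" and m: "\<forall>i. m i > 0"
  shows "level_stab m n \<subseteq> level_stab m k"
proof -
  have "level_stab m (Suc n) \<subseteq> level_stab m n" for n
  proof
    fix g assume g: "g \<in> level_stab m (Suc n)"
    have "g v = v" if v: "v \<in> tree_level m n" for v
    proof -
      have v0: "v @ [0] \<in> tree_level m (Suc n)"
        using v m by (auto simp: tree_level_def tree_verts_def nth_append less_Suc_eq)
      then have "g (v @ [0]) = v @ [0]" using g by (auto simp: level_stab_def)
      moreover obtain y where "g (v @ [0]) = g v @ [y]"
        using tree_aut_child[of g m v 0] g v0 by (auto simp: level_stab_def tree_level_def)
      ultimately show ?thesis by simp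
    qed
    then show "g \<in> level_stab m n" using g by (auto simp: level_stab_def)
  qed
  then show ?thesis using lift_Suc_antimono_le[of "level_stab m"] assms(1) by blast
qed

definition congruence_topology :: "(nat \<Rightarrow> nat) \<Rightarrow> (nat list \<Rightarrow> nat list) topology" where
  "congruence_topology m = topology (\<lambda>U. U \<subseteq> tree_aut m \<and>
     (\<forall>g\<in>U. \<exists>n. g <#\<^bsub>Aut_tree m\<^esub> level_stab m n \<subseteq> U))"

lemma openin_congruence_topology:
  assumes m: "\<forall>i. m i > 0"
  shows "openin (congruence_topology m) U \<longleftrightarrow>
    U \<subseteq> tree_aut m \<and> (\<forall>g\<in>U. \<exists>n. g <#\<^bsub>Aut_tree m\<^esub> level_stab m n \<subseteq> U)"
proof -
  let ?P = "\<lambda>U. U \<subseteq> tree_aut m \<and> (\<forall>g\<in>U. \<exists>n. g <#\<^bsub>Aut_tree m\<^esub> level_stab m n \<subseteq> U)"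
  have "istopology ?P"
    unfolding istopology_def
  proof (rule conjI; intro allI impI)
    fix S T assume S: "?P S" and T: "?P T"
    have "\<exists>n. g <#\<^bsub>Aut_tree m\<^esub> level_stab m n \<subseteq> S \<inter> T" if g: "g \<in> S \<inter> T" for g
    proof -
      obtain a b where ab: "g <#\<^bsub>Aut_tree m\<^esub> level_stab m a \<subseteq> S"
          "g <#\<^bsub>Aut_tree m\<^esub> level_stab m b \<subseteq> T"
        using S T g by blast
      have "level_stab m (max a b) \<subseteq> level_stab m a" "level_stab m (max a b) \<subseteq> level_stab m b"
        using m by (simp_all add: level_stab_antimono)
      then have "g <#\<^bsub>Aut_tree m\<^esub> level_stab m (max a b) \<subseteq> S \<inter> T"
        using ab unfolding l_coset_def by blast
      then show ?thesis ..
    qed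
    then show "?P (S \<inter> T)" using S by blast
  next
    fix \<K> assume K: "\<forall>K\<in>\<K>. ?P K"
    then show "?P (\<Union>\<K>)"
      by (meson Sup_le_iff Union_iff Union_upper order_trans)
  qed
  then show ?thesis by (simp add: congruence_topology_def)
qed

definition level_transitive :: "(nat \<Rightarrow> nat) \<Rightarrow> (nat list \<Rightarrow> nat list) set \<Rightarrow> bool" where
  "level_transitive m G \<longleftrightarrow>
     (\<forall>n. \<forall>u\<in>tree_level m n. \<forall>v\<in>tree_level m n. \<exists>g\<in>G. g u = v)"

definition rist ::
    "(nat \<Rightarrow> nat) \<Rightarrow> (nat list \<Rightarrow> nat list) set \<Rightarrow> nat list \<Rightarrow> (nat list \<Rightarrow> nat list) set" where
  "rist m G v = {g \<in> G. g v = v \<and> (\<forall>u\<in>tree_verts m. \<not> prefix v u \<longrightarrow> g u = u)}"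

text \<open>
  Rigid stabilizers of distinct vertices of one level commute elementwise and intersect trivially,
  so that their internal (direct) product is the subgroup which they generate.
\<close>

definition Rist ::
    "(nat \<Rightarrow> nat) \<Rightarrow> (nat list \<Rightarrow> nat list) set \<Rightarrow> nat \<Rightarrow> (nat list \<Rightarrow> nat list) set" where
  "Rist m G n = generate (Aut_tree m) (\<Union>v\<in>tree_level m n. rist m G v)"

definition filtration ::
    "(nat \<Rightarrow> nat) \<Rightarrow> (nat list \<Rightarrow> nat list) set \<Rightarrow> (nat \<Rightarrow> (nat list \<Rightarrow> nat list) set) \<Rightarrow> bool" where
  "filtration m G N \<longleftrightarrow>
     N 0 = G \<and>
     (\<forall>i. N (Suc i) \<subseteq> N i) \<and>
     (\<forall>i. N i \<lhd> (Aut_tree m)\<lparr>carrier := G\<rparr>) \<and>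
     (\<forall>i. openin (subtopology (congruence_topology m) G) (N i)) \<and>
     (\<Inter>i. N i) = {\<one>\<^bsub>Aut_tree m\<^esub>}"

text \<open>The quotient \<open>HN / N\<close> for a subgroup \<open>H\<close> normalizing \<open>N\<close>.\<close>

definition prod_quot ::
    "(nat \<Rightarrow> nat) \<Rightarrow> (nat list \<Rightarrow> nat list) set \<Rightarrow> (nat list \<Rightarrow> nat list) set
      \<Rightarrow> (nat list \<Rightarrow> nat list) set monoid" where
  "prod_quot m H N = (Aut_tree m)\<lparr>carrier := H <#>\<^bsub>Aut_tree m\<^esub> N\<rparr> Mod N"

definition nice_filtration ::
    "(nat \<Rightarrow> nat) \<Rightarrow> (nat list \<Rightarrow> nat list) set \<Rightarrow> (nat \<Rightarrow> (nat list \<Rightarrow> nat list) set) \<Rightarrow> bool" where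
  "nice_filtration m G N \<longleftrightarrow>
     filtration m G N \<and>
     (\<forall>k\<ge>1. finite {i. \<not> prod_quot m (Rist m G k) (N i) \<cong>
        product_group (tree_level m k) (\<lambda>v. prod_quot m (rist m G v) (N i))})"

text \<open>
  The index \<open>|K : N|\<close>. It is only used for \<open>N\<close> open in a compact group, hence for finite
  indices; \<^const>\<open>card\<close> would give \<open>0\<close> for an infinite one.
\<close>

definition subgroup_index ::
    "(nat \<Rightarrow> nat) \<Rightarrow> (nat list \<Rightarrow> nat list) set \<Rightarrow> (nat list \<Rightarrow> nat list) set \<Rightarrow> nat" where
  "subgroup_index m K N = card (rcosets\<^bsub>(Aut_tree m)\<lparr>carrier := K\<rparr>\<^esub> N)"

text \<open>
  If \<open>G\<close> is non-trivial, then \<open>|G : N i| > 1\<close> for all but finitely many \<open>i\<close>, so the convention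
  \<open>x / 0 = 0\<close> does not affect the value of the lower limit.
\<close>

definition hdim ::
    "(nat \<Rightarrow> nat) \<Rightarrow> (nat list \<Rightarrow> nat list) set \<Rightarrow> (nat \<Rightarrow> (nat list \<Rightarrow> nat list) set)
      \<Rightarrow> (nat list \<Rightarrow> nat list) set \<Rightarrow> ereal" where
  "hdim m G N H = liminf (\<lambda>i. ereal
     (ln (real (subgroup_index m (H <#>\<^bsub>Aut_tree m\<^esub> N i) (N i))) /
      ln (real (subgroup_index m G (N i)))))"

definition hspec ::
    "(nat \<Rightarrow> nat) \<Rightarrow> (nat list \<Rightarrow> nat list) set \<Rightarrow> (nat \<Rightarrow> (nat list \<Rightarrow> nat list) set)
      \<Rightarrow> ereal set" where
  "hspec m G N = {hdim m G N H | H. subgroup H ((Aut_tree m)\<lparr>carrier := G\<rparr>) \<and>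
     closedin (subtopology (congruence_topology m) G) H}"

end

theory Submission
  imports Defs
begin

text \<open>Modulo \<open>N i\<close>, a group generated by the rigid stabilizers of finitely many pairwise incomparable
vertices is a product, so the logarithm of its index is at most the sum of the logarithmic indices
of the factors (\<open>log_ratio_rist_join_le\<close>). For a whole level, niceness and conjugacy under the
level-transitive group turn this into an equality with equal summands, and full dimensionality
makes the total asymptotic to \<open>log |G : N i|\<close>. Hence the rigid stabilizer of a vertex of level
\<open>n \<ge> 1\<close> has dimension \<open>1 / level_size m n\<close>, as a limit and not only as a lower limit
(\<open>log_ratio_rist_tendsto\<close>), just as the vertex covers this proportion of the boundary of the tree.

To realize \<open>\<alpha> \<in> [0, 1)\<close>, take the ray described by the mixed radix digits of \<open>\<alpha>\<close> and let \<open>H\<close> be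
generated by the rigid stabilizers of all vertices that branch off this ray to the left. Cutting
at level \<open>k\<close>, the group \<open>H\<close> is contained in the product over the left branches above level \<open>k\<close> and
the vertex of the ray; this bounds the dimension by the truncation of \<open>\<alpha>\<close> plus the weight of one
vertex. Conversely, \<open>H\<close> together with that vertex and the right branches covers the rigid stabilizer
of the whole level, whose dimension is \<open>1\<close>, and this bounds the dimension from below by the
truncation (\<open>ex_subgroup_log_ratio_tendsto\<close>). The levels grow without bound, for otherwise deep
rigid stabilizers would be trivial, so the two bounds meet at \<open>\<alpha>\<close>. The value \<open>1\<close> is attained by a
rigid level stabilizer.

The group \<open>H\<close> need not be closed, but the intersection of the groups \<open>H N i\<close> is closed and has the
same image as \<open>H\<close> in each quotient (\<open>ex_closed_subgroup_same_hdim\<close>).\<close>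

section \<open>Counting the cosets of a normal subgroup that meet a set\<close>

text \<open>The size of the image of a set \<open>A\<close> in the quotient by \<open>N\<close>. For a subgroup \<open>A\<close> this is the index
\<open>|AN : N|\<close>; for arbitrary sets it behaves well under products and conjugation.\<close>

definition coset_count :: "('a, 'b) monoid_scheme \<Rightarrow> 'a set \<Rightarrow> 'a set \<Rightarrow> nat" where
  "coset_count G N A = card (r_coset G N ` A)"

lemma rcosets_eq_image: "rcosets\<^bsub>G\<^esub> N = r_coset G N ` carrier G"
  unfolding RCOSETS_def by blast

lemma set_multI: "a \<in> A \<Longrightarrow> b \<in> B \<Longrightarrow> a \<otimes>\<^bsub>G\<^esub> b \<in> A <#>\<^bsub>G\<^esub> B"
  unfolding set_mult_def by blast

context normal
begin

lemma coset_count_mono: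
  assumes "finite (rcosets H)" and "A \<subseteq> B" and "B \<subseteq> carrier G"
  shows "coset_count G H A \<le> coset_count G H B"
proof -
  have "finite (r_coset G H ` B)"
    using assms(1,3) finite_subset[OF image_mono[of B "carrier G" "r_coset G H"]]
    by (simp add: rcosets_eq_image)
  then show ?thesis
    unfolding coset_count_def by (rule card_mono) (use assms(2) in blast)
qed

lemma coset_count_pos:
  assumes "finite (rcosets H)" and "A \<subseteq> carrier G" and "A \<noteq> {}"
  shows "coset_count G H A > 0"
proof -
  have "finite (r_coset G H ` A)"
    using assms(1,2) finite_subset[OF image_mono[of A "carrier G" "r_coset G H"]]
    by (simp add: rcosets_eq_image)
  then show ?thesis
    unfolding coset_count_def using assms(3) by (simp add: card_gt_0_iff)
qed

text \<open>The image in the quotient of a product of sets is the product of the images. This rests on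
normality alone and so applies to products of sets that are not groups.\<close>

lemma coset_count_set_mult_le:
  assumes "finite (rcosets H)" and A: "A \<subseteq> carrier G" and B: "B \<subseteq> carrier G"
  shows "coset_count G H (A <#> B) \<le> coset_count G H A * coset_count G H B"
proof -
  let ?q = "r_coset G H"
  have fin: "finite (?q ` A)" "finite (?q ` B)"
    using assms finite_subset[OF image_mono[of _ "carrier G" ?q]]
    by (simp_all add: rcosets_eq_image)
  have "?q (a \<otimes> b) \<in> (\<lambda>(C, D). C <#> D) ` (?q ` A \<times> ?q ` B)" if "a \<in> A" "b \<in> B" for a b
  proof -
    have "?q (a \<otimes> b) = ?q a <#> ?q b"
      using rcos_sum[of a b] that A B by auto
    then show ?thesis using that by force
  qed
  then have "?q ` (A <#> B) \<subseteq> (\<lambda>(C, D). C <#> D) ` (?q ` A \<times> ?q ` B)"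
    by (auto simp: set_mult_def)
  then have "card (?q ` (A <#> B)) \<le> card (?q ` A \<times> ?q ` B)"
    using fin by (meson card_image_le card_mono finite_SigmaI finite_imageI order_trans)
  then show ?thesis by (simp add: coset_count_def card_cartesian_product)
qed

text \<open>Conjugation by \<open>k\<close> induces an automorphism of the quotient, and the image of \<open>B\<close> is carried
onto a set containing the image of \<open>A\<close> by its inverse.\<close>

lemma coset_count_conj_le:
  assumes fin: "finite (rcosets H)" and k: "k \<in> carrier G"
    and A: "A \<subseteq> carrier G" and B: "B \<subseteq> carrier G"
    and conj: "\<And>a. a \<in> A \<Longrightarrow> k \<otimes> a \<otimes> inv k \<in> B"
  shows "coset_count G H A \<le> coset_count G H B"
proof -
  let ?q = "r_coset G H"
  have finB: "finite (?q ` B)"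
    using fin B finite_subset[OF image_mono[of _ "carrier G" ?q]] by (simp add: rcosets_eq_image)
  have "?q a \<in> (\<lambda>C. ?q (inv k) <#> C <#> ?q k) ` (?q ` B)" if a: "a \<in> A" for a
  proof -
    have aG: "a \<in> carrier G" using a A by blast
    have "inv k \<otimes> (k \<otimes> a \<otimes> inv k) \<otimes> k = a"
      using aG k by (simp add: m_assoc) (simp flip: m_assoc)
    then have "?q a = ?q (inv k \<otimes> (k \<otimes> a \<otimes> inv k) \<otimes> k)"
      by simp
    also have "\<dots> = ?q (inv k) <#> ?q (k \<otimes> a \<otimes> inv k) <#> ?q k"
      using aG k by (simp add: rcos_sum)
    finally show ?thesis using conj[OF a] by blast
  qed
  then have "card (?q ` A) \<le> card (?q ` B)"
    using finB by (meson card_image_le card_mono finite_imageI image_subsetI order_trans)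
  then show ?thesis by (simp add: coset_count_def)
qed

text \<open>This removes the factor \<open>H\<close> from the indices \<open>|AH : H|\<close> that enter the Hausdorff dimension.\<close>

lemma rcosets_of_set_mult:
  assumes A: "A \<subseteq> carrier G"
  shows "r_coset G H ` (A <#> H) = r_coset G H ` A"
proof
  have "H #> (a \<otimes> h) = H #> a" if "a \<in> A" "h \<in> H" for a h
  proof -
    have a: "a \<in> carrier G" and h: "h \<in> carrier G" using that A subset by auto
    have "H #> (a \<otimes> h) = (H #> a) <#> (H #> h)" using a h by (simp add: rcos_sum)
    also have "H #> h = H #> \<one>"
      unfolding coset_join2[OF h is_subgroup that(2)] coset_mult_one[OF subset] by (rule refl)
    also have "(H #> a) <#> (H #> \<one>) = H #> a"
      unfolding rcos_sum[OF a one_closed] r_one[OF a] by (rule refl)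
    finally show ?thesis .
  qed
  then show "r_coset G H ` (A <#> H) \<subseteq> r_coset G H ` A"
    by (auto simp: set_mult_def)
  have "a \<in> A <#> H" if "a \<in> A" for a
  proof -
    have "a \<otimes> \<one> \<in> A <#> H" by (rule set_multI[OF that subgroup.one_closed[OF is_subgroup]])
    then show ?thesis using r_one[of a] A that by auto
  qed
  then show "r_coset G H ` A \<subseteq> r_coset G H ` (A <#> H)" by blast
qed

end

lemma (in group) subgroup_set_mult:
  assumes A: "subgroup A G" and B: "subgroup B G"
    and swap: "\<And>a b. a \<in> A \<Longrightarrow> b \<in> B \<Longrightarrow> b \<otimes> a \<in> A <#> B"
  shows "subgroup (A <#> B) G"
proof (rule subgroupI)
  note [simp] = subgroup.mem_carrier[OF A] subgroup.mem_carrier[OF B]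
  show "A <#> B \<subseteq> carrier G"
    by (auto simp: set_mult_def)
  show "A <#> B \<noteq> {}"
    using subgroup.one_closed[OF A] subgroup.one_closed[OF B] by (auto simp: set_mult_def)
  show "inv x \<in> A <#> B" if "x \<in> A <#> B" for x
  proof -
    obtain a b where x: "a \<in> A" "b \<in> B" "x = a \<otimes> b" using \<open>x \<in> A <#> B\<close> by (auto simp: set_mult_def)
    then have "inv x = inv b \<otimes> inv a" by (simp add: inv_mult_group)
    then show ?thesis
      using swap[OF subgroup.m_inv_closed[OF A x(1)] subgroup.m_inv_closed[OF B x(2)]] by simp
  qed
  show "x \<otimes> y \<in> A <#> B" if xy: "x \<in> A <#> B" "y \<in> A <#> B" for x y
  proof -
    obtain a b where x: "a \<in> A" "b \<in> B" "x = a \<otimes> b" using xy(1) by (auto simp: set_mult_def)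
    obtain c d where y: "c \<in> A" "d \<in> B" "y = c \<otimes> d" using xy(2) by (auto simp: set_mult_def)
    obtain c' b' where s: "c' \<in> A" "b' \<in> B" "b \<otimes> c = c' \<otimes> b'"
      using swap[of c b] x y by (auto simp: set_mult_def)
    have "x \<otimes> y = a \<otimes> (b \<otimes> c) \<otimes> d" using x y by (simp add: m_assoc)
    also have "\<dots> = (a \<otimes> c') \<otimes> (b' \<otimes> d)" using x y s by (simp add: m_assoc)
    finally have "x \<otimes> y = (a \<otimes> c') \<otimes> (b' \<otimes> d)" .
    moreover have "a \<otimes> c' \<in> A" "b' \<otimes> d \<in> B"
      using x y s subgroup.m_closed[OF A] subgroup.m_closed[OF B] by simp_all
    ultimately show ?thesis by (metis set_multI)
  qed
qed

section \<open>Automorphisms of the tree\<close>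

lemma snoc_in_tree_verts_iff:
  "v @ [x] \<in> tree_verts m \<longleftrightarrow> v \<in> tree_verts m \<and> x < m (length v)"
  by (auto simp: tree_verts_def nth_append less_Suc_eq)

lemma tree_level_0 [simp]: "tree_level m 0 = {[]}"
  by (auto simp: tree_level_def)

lemma tree_level_Suc:
  "tree_level m (Suc n) = (\<lambda>(v, x). v @ [x]) ` (tree_level m n \<times> {..<m n})"
proof (intro equalityI subsetI)
  fix w assume w: "w \<in> tree_level m (Suc n)"
  then obtain v x where vx: "w = v @ [x]"
    by (cases w rule: rev_cases) (auto simp: tree_level_def)
  then have "v \<in> tree_level m n" "x < m n"
    using w by (auto simp: tree_level_def snoc_in_tree_verts_iff)
  then show "w \<in> (\<lambda>(v, x). v @ [x]) ` (tree_level m n \<times> {..<m n})"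
    using vx by force
qed (auto simp: tree_level_def snoc_in_tree_verts_iff)

lemma finite_tree_level: "finite (tree_level m n)"
  by (induction n) (simp_all add: tree_level_Suc)

definition level_size :: "(nat \<Rightarrow> nat) \<Rightarrow> nat \<Rightarrow> nat" where
  "level_size m n = (\<Prod>i<n. m i)"

lemma card_tree_level: "card (tree_level m n) = level_size m n"
proof (induction n)
  case (Suc n)
  have "inj_on (\<lambda>(v, x). v @ [x]) (tree_level m n \<times> {..<m n})"
    by (auto simp: inj_on_def)
  then show ?case
    by (simp add: tree_level_Suc card_image card_cartesian_product Suc.IH level_size_def)
qed (simp add: level_size_def)

lemma tree_aut_length:
  assumes "f \<in> tree_aut m" and "v \<in> tree_verts m"
  shows "length (f v) = length v"
  using assms(2)
proof (induction v rule: rev_induct)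
  case Nil
  then show ?case using assms(1) by (simp add: tree_aut_def)
next
  case (snoc x v)
  then show ?case using tree_aut_child[OF assms(1) snoc.prems] snoc_in_tree_verts_iff by auto
qed

lemma tree_aut_in_verts:
  assumes "f \<in> tree_aut m" and "v \<in> tree_verts m"
  shows "f v \<in> tree_verts m"
  using assms Bij_imp_funcset[of f "tree_verts m"] by (auto simp: tree_aut_def)

lemma tree_aut_in_level:
  assumes "f \<in> tree_aut m" and "v \<in> tree_level m n"
  shows "f v \<in> tree_level m n"
  using assms tree_aut_length tree_aut_in_verts by (auto simp: tree_level_def)

lemma tree_aut_prefix:
  assumes f: "f \<in> tree_aut m" and "u \<in> tree_verts m" and "prefix v u"
  shows "prefix (f v) (f u)"
  using assms(2,3)
proof (induction u rule: rev_induct)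
  case Nil
  then show ?case by simp
next
  case (snoc x u)
  obtain y where y: "f (u @ [x]) = f u @ [y]" using tree_aut_child[OF f snoc.prems(1)] by blast
  show ?case
  proof (cases "v = u @ [x]")
    case False
    then have "prefix v u" using snoc.prems(2) by (simp add: prefix_snoc)
    then show ?thesis using snoc y snoc_in_tree_verts_iff by (simp add: prefix_prefix)
  qed simp
qed

lemma mult_Aut_tree [simp]:
  assumes "f \<in> tree_aut m" and "g \<in> tree_aut m" and "v \<in> tree_verts m"
  shows "(f \<otimes>\<^bsub>Aut_tree m\<^esub> g) v = f (g v)"
  using assms by (simp add: Aut_tree_def BijGroup_def tree_aut_def compose_def)

lemma one_Aut_tree [simp]:
  assumes "v \<in> tree_verts m"
  shows "\<one>\<^bsub>Aut_tree m\<^esub> v = v"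
  using assms by (simp add: Aut_tree_def BijGroup_def)

lemma inv_in_tree_aut [simp]: "f \<in> tree_aut m \<Longrightarrow> inv\<^bsub>Aut_tree m\<^esub> f \<in> tree_aut m"
  using group.inv_closed[OF group_Aut_tree, of f m] by simp

lemma inv_Aut_tree_left [simp]:
  assumes "f \<in> tree_aut m" and "v \<in> tree_verts m"
  shows "(inv\<^bsub>Aut_tree m\<^esub> f) (f v) = v"
  using assms group.l_inv[OF group_Aut_tree, of f m] mult_Aut_tree[of "inv\<^bsub>Aut_tree m\<^esub> f" m f v]
  by simp

lemma inv_Aut_tree_right [simp]:
  assumes "f \<in> tree_aut m" and "v \<in> tree_verts m"
  shows "f ((inv\<^bsub>Aut_tree m\<^esub> f) v) = v"
  using assms group.r_inv[OF group_Aut_tree, of f m] mult_Aut_tree[of f m "inv\<^bsub>Aut_tree m\<^esub> f" v]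
  by simp

lemma tree_aut_eqI:
  assumes "f \<in> tree_aut m" and "g \<in> tree_aut m" and "\<And>v. v \<in> tree_verts m \<Longrightarrow> f v = g v"
  shows "f = g"
  using assms by (auto simp: tree_aut_def Bij_def intro: extensionalityI)

lemma tree_aut_prefix_iff:
  assumes f: "f \<in> tree_aut m" and u: "u \<in> tree_verts m" and v: "v \<in> tree_verts m"
  shows "prefix (f v) (f u) \<longleftrightarrow> prefix v u"
  using tree_aut_prefix[OF f u, of v]
    tree_aut_prefix[OF inv_in_tree_aut[OF f] tree_aut_in_verts[OF f u], of "f v"] assms
  by auto

lemma mult_in_tree_aut [simp]:
  "f \<in> tree_aut m \<Longrightarrow> g \<in> tree_aut m \<Longrightarrow> f \<otimes>\<^bsub>Aut_tree m\<^esub> g \<in> tree_aut m"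
  using monoid.m_closed[OF group.is_monoid[OF group_Aut_tree], of f m g] by simp

lemma one_in_tree_aut [simp]: "\<one>\<^bsub>Aut_tree m\<^esub> \<in> tree_aut m"
  using monoid.one_closed[OF group.is_monoid[OF group_Aut_tree], of m] by simp

section \<open>Rigid stabilizers\<close>

lemma subgroup_rist:
  assumes G: "subgroup G (Aut_tree m)" and v: "v \<in> tree_verts m"
  shows "subgroup (rist m G v) (Aut_tree m)"
proof -
  have sub: "f \<in> tree_aut m" if "f \<in> G" for f
    using subgroup.mem_carrier[OF G that] by simp
  have inv: "(inv\<^bsub>Aut_tree m\<^esub> f) u = u" if "f \<in> G" "u \<in> tree_verts m" "f u = u" for f u
    using inv_Aut_tree_left[OF sub[OF that(1)] that(2)] that(3) by simp
  show ?thesis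
  proof (rule group.subgroupI[OF group_Aut_tree])
    show "rist m G v \<subseteq> carrier (Aut_tree m)"
      using sub by (auto simp: rist_def)
    have "\<one>\<^bsub>Aut_tree m\<^esub> \<in> rist m G v"
      using subgroup.one_closed[OF G] v by (simp add: rist_def)
    then show "rist m G v \<noteq> {}" by blast
    show "inv\<^bsub>Aut_tree m\<^esub> f \<in> rist m G v" if "f \<in> rist m G v" for f
      using that subgroup.m_inv_closed[OF G] v by (auto simp: rist_def inv)
    show "f \<otimes>\<^bsub>Aut_tree m\<^esub> g \<in> rist m G v" if "f \<in> rist m G v" "g \<in> rist m G v" for f g
      using that subgroup.m_closed[OF G] v by (auto simp: rist_def sub)
  qed
qed

lemma rist_antimono:
  assumes "prefix v w" and "v \<in> tree_verts m" and G: "G \<subseteq> tree_aut m"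
  shows "rist m G w \<subseteq> rist m G v"
proof
  fix g assume g: "g \<in> rist m G w"
  have "g v = v"
  proof (cases "v = w")
    case False
    then have "\<not> prefix w v" using assms(1) prefix_order.antisym by blast
    then show ?thesis using g assms(2) by (simp add: rist_def)
  qed (use g in \<open>simp add: rist_def\<close>)
  moreover have "\<not> prefix w u" if "\<not> prefix v u" for u
    using that assms(1) prefix_order.trans by blast
  ultimately show "g \<in> rist m G v" using g by (auto simp: rist_def)
qed

text \<open>An automorphism carries the subtree at \<open>v\<close> onto the subtree at its image. In a level-transitive
group all rigid stabilizers of one level are therefore conjugate.\<close>

lemma rist_conj:
  assumes G: "subgroup G (Aut_tree m)" and k: "k \<in> G" and g: "g \<in> rist m G v"
    and v: "v \<in> tree_verts m"
  shows "k \<otimes>\<^bsub>Aut_tree m\<^esub> g \<otimes>\<^bsub>Aut_tree m\<^esub> inv\<^bsub>Aut_tree m\<^esub> k \<in> rist m G (k v)"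
proof -
  let ?A = "Aut_tree m"
  have gG: "g \<in> G" using g by (simp add: rist_def)
  have kA: "k \<in> tree_aut m" and gA: "g \<in> tree_aut m"
    using subgroup.mem_carrier[OF G] k gG by auto
  have val: "(k \<otimes>\<^bsub>?A\<^esub> g \<otimes>\<^bsub>?A\<^esub> inv\<^bsub>?A\<^esub> k) u = k (g ((inv\<^bsub>?A\<^esub> k) u))"
    if "u \<in> tree_verts m" for u
    using that kA gA tree_aut_in_verts[OF inv_in_tree_aut[OF kA] that] by simp
  have "k \<otimes>\<^bsub>?A\<^esub> g \<otimes>\<^bsub>?A\<^esub> inv\<^bsub>?A\<^esub> k \<in> G"
    using G k gG by (simp add: subgroup.m_closed subgroup.m_inv_closed)
  moreover have "k (g ((inv\<^bsub>?A\<^esub> k) (k v))) = k v"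
    using g v kA by (simp add: rist_def)
  moreover have "k (g ((inv\<^bsub>?A\<^esub> k) u)) = u" if u: "u \<in> tree_verts m" "\<not> prefix (k v) u" for u
  proof -
    let ?u = "(inv\<^bsub>?A\<^esub> k) u"
    have uV: "?u \<in> tree_verts m" using kA u(1) by (simp add: tree_aut_in_verts)
    have "\<not> prefix v ?u" using u tree_aut_prefix_iff[OF kA uV v] kA by simp
    then have "g ?u = ?u" using g uV by (simp add: rist_def)
    then show ?thesis using kA u by simp
  qed
  ultimately show ?thesis
    using val tree_aut_in_verts[OF kA v] by (simp add: rist_def)
qed

text \<open>Incomparable vertices have disjoint subtrees, and each of the two automorphisms fixes the subtree
of the other one pointwise and maps its own subtree onto itself.\<close>

lemma rist_commute:
  assumes G: "G \<subseteq> tree_aut m" and v: "v \<in> tree_verts m" and w: "w \<in> tree_verts m"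
    and inc: "v \<parallel> w" and f: "f \<in> rist m G v" and g: "g \<in> rist m G w"
  shows "f \<otimes>\<^bsub>Aut_tree m\<^esub> g = g \<otimes>\<^bsub>Aut_tree m\<^esub> f"
proof (rule tree_aut_eqI)
  have fA: "f \<in> tree_aut m" and gA: "g \<in> tree_aut m" using f g G by (auto simp: rist_def)
  then show "f \<otimes>\<^bsub>Aut_tree m\<^esub> g \<in> tree_aut m" "g \<otimes>\<^bsub>Aut_tree m\<^esub> f \<in> tree_aut m" by simp_all
  have disj: "\<not> (prefix v u \<and> prefix w u)" for u
    using inc prefix_same_cases by blast
  have off: "f u = u" if "u \<in> tree_verts m" "\<not> prefix v u" for u
    using that f by (simp add: rist_def)
  have off': "g u = u" if "u \<in> tree_verts m" "\<not> prefix w u" for u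
    using that g by (simp add: rist_def)
  have stay: "prefix v (f u) = prefix v u" if "u \<in> tree_verts m" for u
    using tree_aut_prefix_iff[OF fA that v] f by (simp add: rist_def)
  have stay': "prefix w (g u) = prefix w u" if "u \<in> tree_verts m" for u
    using tree_aut_prefix_iff[OF gA that w] g by (simp add: rist_def)
  fix u assume u: "u \<in> tree_verts m"
  have "f (g u) = g (f u)"
    using disj off off' stay stay' u tree_aut_in_verts[OF fA u] tree_aut_in_verts[OF gA u]
    by metis
  then show "(f \<otimes>\<^bsub>Aut_tree m\<^esub> g) u = (g \<otimes>\<^bsub>Aut_tree m\<^esub> f) u"
    using fA gA u by simp
qed

section \<open>Filtered groups of tree automorphisms\<close>

locale filtered_tree_group =
  fixes m :: "nat \<Rightarrow> nat"
    and G :: "(nat list \<Rightarrow> nat list) set"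
    and N :: "nat \<Rightarrow> (nat list \<Rightarrow> nat list) set"
  assumes m_pos: "\<forall>i. m i > 0"
    and subgroup_G: "subgroup G (Aut_tree m)"
    and filtration: "filtration m G N"
begin

abbreviation grp :: "(nat list \<Rightarrow> nat list) monoid" where
  "grp \<equiv> (Aut_tree m)\<lparr>carrier := G\<rparr>"

abbreviation index_mod :: "nat \<Rightarrow> (nat list \<Rightarrow> nat list) set \<Rightarrow> nat" where
  "index_mod i A \<equiv> coset_count grp (N i) A"

sublocale A: group "Aut_tree m"
  by (rule group_Aut_tree)

sublocale grp: group grp
  by (rule subgroup.subgroup_is_group[OF subgroup_G group_Aut_tree])

lemma normal_N: "N i \<lhd> grp"
  using filtration by (simp add: filtration_def)

lemma G_subset: "G \<subseteq> tree_aut m"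
  using subgroup.subset[OF subgroup_G] by simp

lemma inv_grp: "g \<in> G \<Longrightarrow> inv\<^bsub>grp\<^esub> g = inv\<^bsub>Aut_tree m\<^esub> g"
  by (rule A.m_inv_consistent[OF subgroup_G])

text \<open>An open subgroup contains a neighbourhood of the identity, and the level stabilizers form a basis
of these.\<close>

lemma level_stab_subset_N: "\<exists>n. level_stab m n \<inter> G \<subseteq> N i"
proof -
  obtain T where T: "openin (congruence_topology m) T" "N i = T \<inter> G"
    using filtration unfolding filtration_def openin_subtopology by blast
  have "\<one>\<^bsub>Aut_tree m\<^esub> \<in> N i"
    using subgroup.one_closed[OF normal_imp_subgroup[OF normal_N]] by simp
  then obtain n where n: "\<one>\<^bsub>Aut_tree m\<^esub> <#\<^bsub>Aut_tree m\<^esub> level_stab m n \<subseteq> T"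
    using T openin_congruence_topology[OF m_pos] by blast
  have "s \<in> \<one>\<^bsub>Aut_tree m\<^esub> <#\<^bsub>Aut_tree m\<^esub> level_stab m n" if "s \<in> level_stab m n" for s
  proof -
    have "s = \<one>\<^bsub>Aut_tree m\<^esub> \<otimes>\<^bsub>Aut_tree m\<^esub> s"
      using that by (simp add: level_stab_def)
    then show ?thesis using that unfolding l_coset_def by blast
  qed
  then show ?thesis using n T(2) by blast
qed

text \<open>The coset of \<open>g\<close> modulo \<open>N i\<close> depends only on the permutation that \<open>g\<close> induces on a
sufficiently deep level, and a level has finitely many permutations.\<close>

lemma finite_rcosets_N: "finite (rcosets\<^bsub>grp\<^esub> N i)"
proof -
  obtain n where n: "level_stab m n \<inter> G \<subseteq> N i" using level_stab_subset_N by blast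
  let ?L = "tree_level m n" and ?q = "r_coset grp (N i)"
  \<comment> \<open>If \<open>g\<close> and \<open>h\<close> agree on the level, then \<open>g h\<inverse>\<close> stabilizes it pointwise and so lies in \<open>N i\<close>.\<close>
  have same: "?q g = ?q h" if g: "g \<in> G" and h: "h \<in> G" and eq: "restrict g ?L = restrict h ?L" for g h
  proof -
    let ?s = "g \<otimes>\<^bsub>Aut_tree m\<^esub> inv\<^bsub>Aut_tree m\<^esub> h"
    have gA: "g \<in> tree_aut m" and hA: "h \<in> tree_aut m" using g h G_subset by auto
    have "?s v = v" if v: "v \<in> ?L" for v
    proof -
      have vV: "v \<in> tree_verts m" using v by (simp add: tree_level_def)
      let ?u = "(inv\<^bsub>Aut_tree m\<^esub> h) v"
      have "?u \<in> ?L" using tree_aut_in_level[OF inv_in_tree_aut[OF hA] v] .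
      then have "g ?u = h ?u" using eq by (metis restrict_apply')
      then show ?thesis using gA hA vV by simp
    qed
    then have "?s \<in> level_stab m n" using gA hA by (simp add: level_stab_def)
    moreover have "?s \<in> G"
      using g h by (simp add: subgroup.m_closed[OF subgroup_G] subgroup.m_inv_closed[OF subgroup_G])
    ultimately have "?s \<in> N i" using n by blast
    moreover have "g = ?s \<otimes>\<^bsub>grp\<^esub> h"
      using gA hA by (simp add: A.m_assoc)
    ultimately have "g \<in> N i #>\<^bsub>grp\<^esub> h" unfolding r_coset_def by blast
    then show ?thesis
      using grp.repr_independence[of g "N i" h] h normal_imp_subgroup[OF normal_N] by simp
  qed
  let ?r = "\<lambda>g. restrict g ?L"
  have "?r ` G \<subseteq> (\<Pi>\<^sub>E v\<in>?L. ?L)"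
    using G_subset tree_aut_in_level by fastforce
  then have fin: "finite (?r ` G)"
    using finite_tree_level by (meson finite_PiE finite_subset)
  have "?q ` G \<subseteq> (\<lambda>\<rho>. ?q (SOME h. h \<in> G \<and> ?r h = \<rho>)) ` ?r ` G"
  proof
    fix C assume "C \<in> ?q ` G"
    then obtain g where g: "g \<in> G" "C = ?q g" by blast
    let ?h = "SOME h. h \<in> G \<and> ?r h = ?r g"
    have "?h \<in> G \<and> ?r ?h = ?r g" by (rule someI[of _ g]) (use g in simp)
    then have C: "C = ?q ?h" using same[of g ?h] g by simp
    show "C \<in> (\<lambda>\<rho>. ?q (SOME h. h \<in> G \<and> ?r h = \<rho>)) ` ?r ` G"
      unfolding C image_image by (rule imageI[OF g(1)])
  qed
  then have "finite (?q ` G)" using fin by (meson finite_imageI finite_subset)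
  then show ?thesis by (simp add: rcosets_eq_image)
qed

lemma rcosets_set_mult_N:
  assumes "B \<subseteq> G"
  shows "card (rcosets\<^bsub>(Aut_tree m)\<lparr>carrier := B <#>\<^bsub>Aut_tree m\<^esub> N i\<rparr>\<^esub> (N i)) = index_mod i B"
proof -
  have "rcosets\<^bsub>(Aut_tree m)\<lparr>carrier := B <#>\<^bsub>Aut_tree m\<^esub> N i\<rparr>\<^esub> (N i)
      = r_coset grp (N i) ` (B <#>\<^bsub>grp\<^esub> N i)"
    by (simp add: rcosets_eq_image r_coset_def)
  also have "\<dots> = r_coset grp (N i) ` B"
    using normal.rcosets_of_set_mult[OF normal_N] assms by simp
  finally show ?thesis by (simp add: coset_count_def)
qed

lemma hdim_eq:
  assumes "B \<subseteq> G"
  shows "hdim m G N B = liminf (\<lambda>i. ereal (ln (index_mod i B) / ln (index_mod i G)))"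
  using rcosets_set_mult_N[OF assms]
  by (simp add: hdim_def subgroup_index_def coset_count_def rcosets_eq_image)

lemma card_prod_quot:
  assumes "B \<subseteq> G"
  shows "card (carrier (prod_quot m B (N i))) = index_mod i B"
  using rcosets_set_mult_N[OF assms] by (simp add: prod_quot_def FactGroup_def)

text \<open>The intersection \<open>K\<close> of the groups \<open>H N i\<close> is closed in \<open>G\<close>:
each \<open>H N i\<close> is an open, hence closed, subgroup, and \<open>H \<subseteq> K \<subseteq> H N i\<close> shows that \<open>H\<close> and \<open>K\<close>
have the same image modulo every \<open>N i\<close>. So the spectrum may be computed with arbitrary subgroups.\<close>

lemma ex_closed_subgroup_same_hdim:
  assumes H: "subgroup H grp"
  shows "\<exists>K. subgroup K grp \<and> closedin (subtopology (congruence_topology m) G) K \<and>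
    hdim m G N K = hdim m G N H"
proof (intro exI conjI)
  let ?K = "\<Inter>i. H <#>\<^bsub>grp\<^esub> N i"
  have HG: "H \<subseteq> G" using subgroup.subset[OF H] by simp
  have sub: "subgroup (H <#>\<^bsub>grp\<^esub> N i) grp" for i
  proof (rule grp.subgroup_set_mult[OF H normal_imp_subgroup[OF normal_N]])
    fix a b assume a: "a \<in> H" and b: "b \<in> N i"
    have "b \<otimes>\<^bsub>grp\<^esub> a \<in> N i #>\<^bsub>grp\<^esub> a" using b unfolding r_coset_def by blast
    also have "\<dots> = a <#\<^bsub>grp\<^esub> N i"
      using normal.coset_eq[OF normal_N] a HG by auto
    finally show "b \<otimes>\<^bsub>grp\<^esub> a \<in> H <#>\<^bsub>grp\<^esub> N i"
      using a unfolding l_coset_def set_mult_def by blast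
  qed
  show subK: "subgroup ?K grp"
    by (rule grp.subgroups_Inter) (use sub in auto)
  have KG: "?K \<subseteq> G" using subgroup.subset[OF subK] by simp
  have HK: "H \<subseteq> ?K"
  proof
    fix h assume h: "h \<in> H"
    have "h = h \<otimes>\<^bsub>grp\<^esub> \<one>\<^bsub>grp\<^esub>" using h HG grp.r_one[of h] by auto
    moreover have "h \<otimes>\<^bsub>grp\<^esub> \<one>\<^bsub>grp\<^esub> \<in> H <#>\<^bsub>grp\<^esub> N i" for i
      by (rule set_multI[OF h subgroup.one_closed[OF normal_imp_subgroup[OF normal_N]]])
    ultimately show "h \<in> ?K" by auto
  qed
  have "r_coset grp (N i) ` ?K = r_coset grp (N i) ` H" for i
  proof
    have "r_coset grp (N i) ` ?K \<subseteq> r_coset grp (N i) ` (H <#>\<^bsub>grp\<^esub> N i)" by blast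
    then show "r_coset grp (N i) ` ?K \<subseteq> r_coset grp (N i) ` H"
      using normal.rcosets_of_set_mult[OF normal_N] HG by simp
  qed (use HK in blast)
  then show "hdim m G N ?K = hdim m G N H"
    using hdim_eq[OF KG] hdim_eq[OF HG] by (simp add: coset_count_def)
  have "openin (subtopology (congruence_topology m) G) (G - ?K)"
  proof (subst openin_subopen, intro ballI)
    fix g assume "g \<in> G - ?K"
    then obtain i where g: "g \<in> G" "g \<notin> H <#>\<^bsub>grp\<^esub> N i" by blast
    obtain n where n: "level_stab m n \<inter> G \<subseteq> N i" using level_stab_subset_N by blast
    have gA: "g \<in> tree_aut m" using g G_subset by blast
    let ?T = "g <#\<^bsub>Aut_tree m\<^esub> level_stab m n"
    have one: "\<one>\<^bsub>Aut_tree m\<^esub> \<in> level_stab m n"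
      by (auto simp: level_stab_def tree_level_def)
    have prod: "s \<otimes>\<^bsub>Aut_tree m\<^esub> t \<in> level_stab m n" if "s \<in> level_stab m n" "t \<in> level_stab m n" for s t
      using that by (auto simp: level_stab_def tree_level_def)
    have "\<exists>n. h <#\<^bsub>Aut_tree m\<^esub> level_stab m n \<subseteq> ?T" if h: "h \<in> ?T" for h
    proof -
      obtain s where s: "s \<in> level_stab m n" "h = g \<otimes>\<^bsub>Aut_tree m\<^esub> s"
        using h unfolding l_coset_def by blast
      have "h \<otimes>\<^bsub>Aut_tree m\<^esub> t \<in> ?T" if t: "t \<in> level_stab m n" for t
      proof -
        have "h \<otimes>\<^bsub>Aut_tree m\<^esub> t = g \<otimes>\<^bsub>Aut_tree m\<^esub> (s \<otimes>\<^bsub>Aut_tree m\<^esub> t)"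
          using s t gA by (simp add: level_stab_def A.m_assoc)
        then show ?thesis using prod[OF s(1) t] unfolding l_coset_def by blast
      qed
      then show ?thesis unfolding l_coset_def by blast
    qed
    moreover have "?T \<subseteq> tree_aut m" using gA by (auto simp: l_coset_def level_stab_def)
    ultimately have "openin (congruence_topology m) ?T"
      by (simp add: openin_congruence_topology[OF m_pos])
    then have "openin (subtopology (congruence_topology m) G) (?T \<inter> G)"
      unfolding openin_subtopology by blast
    moreover have "g = g \<otimes>\<^bsub>Aut_tree m\<^esub> \<one>\<^bsub>Aut_tree m\<^esub>" using gA by simp
    then have "g \<in> ?T" using one unfolding l_coset_def by blast
    moreover have "h \<notin> H <#>\<^bsub>grp\<^esub> N i" if h: "h \<in> ?T" "h \<in> G" for h
    proof
      assume hK: "h \<in> H <#>\<^bsub>grp\<^esub> N i"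
      obtain s where s: "s \<in> level_stab m n" "h = g \<otimes>\<^bsub>Aut_tree m\<^esub> s"
        using h unfolding l_coset_def by blast
      have sA: "s \<in> tree_aut m" using s by (simp add: level_stab_def)
      have "s = inv\<^bsub>Aut_tree m\<^esub> g \<otimes>\<^bsub>Aut_tree m\<^esub> h"
        using s sA gA by (simp flip: A.m_assoc)
      then have "s \<in> G"
        using g h subgroup.m_closed[OF subgroup_G] subgroup.m_inv_closed[OF subgroup_G] by simp
      then have sN: "s \<in> N i" using s n by blast
      have one_H: "\<one>\<^bsub>grp\<^esub> \<in> H" by (rule subgroup.one_closed[OF H])
      have "\<one>\<^bsub>grp\<^esub> \<otimes>\<^bsub>grp\<^esub> inv\<^bsub>grp\<^esub> s \<in> H <#>\<^bsub>grp\<^esub> N i"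
        by (rule set_multI[OF one_H subgroup.m_inv_closed[OF normal_imp_subgroup[OF normal_N] sN]])
      then have "h \<otimes>\<^bsub>grp\<^esub> (\<one>\<^bsub>grp\<^esub> \<otimes>\<^bsub>grp\<^esub> inv\<^bsub>grp\<^esub> s) \<in> H <#>\<^bsub>grp\<^esub> N i"
        using subgroup.m_closed[OF sub hK] by blast
      moreover have "h \<otimes>\<^bsub>grp\<^esub> (\<one>\<^bsub>grp\<^esub> \<otimes>\<^bsub>grp\<^esub> inv\<^bsub>grp\<^esub> s) = g"
        using s sA gA \<open>s \<in> G\<close> by (simp add: inv_grp A.m_assoc)
      ultimately show False using g(2) by simp
    qed
    ultimately show "\<exists>T. openin (subtopology (congruence_topology m) G) T \<and> g \<in> T \<and> T \<subseteq> G - ?K"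
      using g(1) by (intro exI[of _ "?T \<inter> G"]) blast
  qed
  moreover have "topspace (subtopology (congruence_topology m) G) = G"
  proof -
    have "openin (congruence_topology m) (tree_aut m)"
      by (auto simp: openin_congruence_topology[OF m_pos] l_coset_def level_stab_def)
    then show ?thesis using G_subset openin_subset by (fastforce simp: topspace_subtopology)
  qed
  ultimately show "closedin (subtopology (congruence_topology m) G) ?K"
    using KG by (simp add: closedin_def)
qed

section \<open>Joins of rigid stabilizers\<close>

abbreviation rist_join :: "nat list set \<Rightarrow> (nat list \<Rightarrow> nat list) set" where
  "rist_join F \<equiv> generate (Aut_tree m) (\<Union>v\<in>F. rist m G v)"

lemma rist_subset: "rist m G v \<subseteq> G"
  by (auto simp: rist_def)

lemma rist_join_subset: "rist_join F \<subseteq> G"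
  by (rule A.generate_subgroup_incl[OF _ subgroup_G]) (use rist_subset in blast)

lemma subgroup_rist_join: "subgroup (rist_join F) (Aut_tree m)"
  by (rule A.generate_is_subgroup) (use rist_subset G_subset in fastforce)

lemma one_in_rist_join: "\<one>\<^bsub>Aut_tree m\<^esub> \<in> rist_join F"
  by (rule generate.one)

lemma rist_join_leI:
  assumes "\<And>v. v \<in> F \<Longrightarrow> v \<in> tree_verts m" and "\<And>v. v \<in> E \<Longrightarrow> \<exists>w\<in>F. prefix w v"
  shows "rist_join E \<subseteq> rist_join F"
proof (rule A.mono_generate, rule UN_least)
  fix v assume "v \<in> E"
  then obtain w where "w \<in> F" "prefix w v" using assms(2) by blast
  then show "rist m G v \<subseteq> (\<Union>w\<in>F. rist m G w)"
    using rist_antimono[OF _ assms(1) G_subset] by blast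
qed

text \<open>The centralizer of \<open>a\<close> is a subgroup, so it contains what its elements generate.\<close>

lemma generate_commute:
  assumes S: "S \<subseteq> tree_aut m" and a: "a \<in> tree_aut m"
    and comm: "\<And>s. s \<in> S \<Longrightarrow> a \<otimes>\<^bsub>Aut_tree m\<^esub> s = s \<otimes>\<^bsub>Aut_tree m\<^esub> a"
    and b: "b \<in> generate (Aut_tree m) S"
  shows "a \<otimes>\<^bsub>Aut_tree m\<^esub> b = b \<otimes>\<^bsub>Aut_tree m\<^esub> a"
  using b
proof (induction rule: generate.induct)
  case one
  then show ?case using a by simp
next
  case (incl h)
  then show ?case by (rule comm)
next
  case (inv h)
  then have h: "h \<in> tree_aut m" using S by blast
  have "inv\<^bsub>Aut_tree m\<^esub> h \<otimes>\<^bsub>Aut_tree m\<^esub> (h \<otimes>\<^bsub>Aut_tree m\<^esub> a) \<otimes>\<^bsub>Aut_tree m\<^esub> inv\<^bsub>Aut_tree m\<^esub> h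
      = inv\<^bsub>Aut_tree m\<^esub> h \<otimes>\<^bsub>Aut_tree m\<^esub> (a \<otimes>\<^bsub>Aut_tree m\<^esub> h) \<otimes>\<^bsub>Aut_tree m\<^esub> inv\<^bsub>Aut_tree m\<^esub> h"
    using comm[OF inv] by simp
  moreover have "inv\<^bsub>Aut_tree m\<^esub> h \<otimes>\<^bsub>Aut_tree m\<^esub> (h \<otimes>\<^bsub>Aut_tree m\<^esub> a) = a"
    using h a by (simp flip: A.m_assoc)
  ultimately show ?case using h a by (simp add: A.m_assoc)
next
  case (eng h1 h2)
  have "h1 \<in> tree_aut m" "h2 \<in> tree_aut m"
    using eng.hyps A.generate_in_carrier[of S] S by auto
  then show ?case using eng.IH a by (metis A.m_assoc carrier_Aut_tree)
qed

text \<open>The two joins commute elementwise, so their product is already a group. Thus the join of a set of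
pairwise incomparable vertices is the product of the rigid stabilizers, which gives access to the
coset count of products.\<close>

lemma rist_join_Un:
  assumes E: "E \<subseteq> tree_verts m" and F: "F \<subseteq> tree_verts m"
    and inc: "\<And>v w. v \<in> E \<Longrightarrow> w \<in> F \<Longrightarrow> v \<parallel> w"
  shows "rist_join (E \<union> F) \<subseteq> rist_join E <#>\<^bsub>Aut_tree m\<^esub> rist_join F"
proof (rule A.generate_subgroup_incl)
  have ristA: "rist m G v \<subseteq> tree_aut m" for v using rist_subset G_subset by blast
  have joinA: "rist_join D \<subseteq> tree_aut m" for D using rist_join_subset G_subset by blast
  have comm: "b \<otimes>\<^bsub>Aut_tree m\<^esub> a = a \<otimes>\<^bsub>Aut_tree m\<^esub> b" if a: "a \<in> rist_join E" and b: "b \<in> rist_join F" for a b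
  proof (rule generate_commute[OF _ _ _ a])
    fix s assume "s \<in> (\<Union>v\<in>E. rist m G v)"
    then obtain v where v: "v \<in> E" "s \<in> rist m G v" by blast
    have "s \<otimes>\<^bsub>Aut_tree m\<^esub> b = b \<otimes>\<^bsub>Aut_tree m\<^esub> s"
    proof (rule generate_commute[OF _ _ _ b])
      fix t assume "t \<in> (\<Union>w\<in>F. rist m G w)"
      then obtain w where w: "w \<in> F" "t \<in> rist m G w" by blast
      then show "s \<otimes>\<^bsub>Aut_tree m\<^esub> t = t \<otimes>\<^bsub>Aut_tree m\<^esub> s"
        using rist_commute[OF G_subset _ _ inc[OF v(1) w(1)] v(2) w(2)] v(1) E F by blast
    qed (use ristA v in blast)+
    then show "b \<otimes>\<^bsub>Aut_tree m\<^esub> s = s \<otimes>\<^bsub>Aut_tree m\<^esub> b" by simp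
  qed (use ristA joinA b in blast)+
  show "subgroup (rist_join E <#>\<^bsub>Aut_tree m\<^esub> rist_join F) (Aut_tree m)"
  proof (rule A.subgroup_set_mult[OF subgroup_rist_join subgroup_rist_join])
    fix a b assume "a \<in> rist_join E" "b \<in> rist_join F"
    then show "b \<otimes>\<^bsub>Aut_tree m\<^esub> a \<in> rist_join E <#>\<^bsub>Aut_tree m\<^esub> rist_join F"
      using comm set_multI by metis
  qed
  have "s \<in> rist_join E <#>\<^bsub>Aut_tree m\<^esub> rist_join F" if s: "s \<in> rist_join E" for s
    using set_multI[OF s one_in_rist_join, of "Aut_tree m" F] A.r_one[of s] subsetD[OF joinA s]
    by simp
  moreover have "s \<in> rist_join E <#>\<^bsub>Aut_tree m\<^esub> rist_join F" if s: "s \<in> rist_join F" for s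
    using set_multI[OF one_in_rist_join s, of "Aut_tree m" E] A.l_one[of s] subsetD[OF joinA s]
    by simp
  moreover have "rist m G v \<subseteq> rist_join D" if "v \<in> D" for v D
    using that generate.incl[of _ "\<Union>v\<in>D. rist m G v"] by blast
  ultimately show "(\<Union>v\<in>E \<union> F. rist m G v) \<subseteq> rist_join E <#>\<^bsub>Aut_tree m\<^esub> rist_join F"
    by blast
qed

lemma rist_join_singleton: "v \<in> tree_verts m \<Longrightarrow> rist_join {v} \<subseteq> rist m G v"
  by (rule A.generate_subgroup_incl[OF _ subgroup_rist[OF subgroup_G]]) auto

section \<open>Logarithmic indices\<close>

text \<open>These are the quotients whose lower limit is the Hausdorff dimension.\<close>

definition log_ratio :: "nat \<Rightarrow> (nat list \<Rightarrow> nat list) set \<Rightarrow> real" where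
  "log_ratio i B = ln (index_mod i B) / ln (index_mod i G)"

lemma index_mod_pos: "B \<subseteq> G \<Longrightarrow> B \<noteq> {} \<Longrightarrow> index_mod i B \<ge> 1"
  using normal.coset_count_pos[OF normal_N finite_rcosets_N, of B i] by simp

lemma index_mod_mono: "B \<subseteq> C \<Longrightarrow> C \<subseteq> G \<Longrightarrow> index_mod i B \<le> index_mod i C"
  using normal.coset_count_mono[OF normal_N finite_rcosets_N, of B C i] by simp

lemma set_mult_subset: "B \<subseteq> G \<Longrightarrow> C \<subseteq> G \<Longrightarrow> B <#>\<^bsub>Aut_tree m\<^esub> C \<subseteq> G"
  using subgroup.m_closed[OF subgroup_G] by (auto simp: set_mult_def)

lemma ln_index_G_nonneg: "ln (real (index_mod i G)) \<ge> 0"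
proof -
  have "G \<noteq> {}" using subgroup.one_closed[OF subgroup_G] by blast
  then show ?thesis using index_mod_pos[of G i] by (intro ln_ge_zero) simp
qed

lemma log_ratio_nonneg:
  assumes "B \<subseteq> G" and "B \<noteq> {}"
  shows "log_ratio i B \<ge> 0"
  unfolding log_ratio_def using index_mod_pos[OF assms, of i]
  by (intro divide_nonneg_nonneg[OF ln_ge_zero ln_index_G_nonneg]) simp

lemma log_ratio_mono:
  assumes "B \<subseteq> C" and "C \<subseteq> G" and "B \<noteq> {}"
  shows "log_ratio i B \<le> log_ratio i C"
proof -
  have "index_mod i B \<ge> 1" using assms by (intro index_mod_pos) auto
  moreover have "index_mod i B \<le> index_mod i C" using assms(1,2) by (rule index_mod_mono)
  ultimately show ?thesis
    unfolding log_ratio_def by (intro divide_right_mono[OF _ ln_index_G_nonneg] ln_mono) auto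
qed

lemma log_ratio_le_1:
  assumes "B \<subseteq> G" and "B \<noteq> {}"
  shows "log_ratio i B \<le> 1"
proof -
  have "log_ratio i B \<le> log_ratio i G" using assms by (intro log_ratio_mono) auto
  also have "\<dots> \<le> 1" by (simp add: log_ratio_def)
  finally show ?thesis .
qed

lemma log_ratio_set_mult_le:
  assumes "B \<subseteq> G" "C \<subseteq> G" "B \<noteq> {}" "C \<noteq> {}"
  shows "log_ratio i (B <#>\<^bsub>Aut_tree m\<^esub> C) \<le> log_ratio i B + log_ratio i C"
proof -
  have prod: "B <#>\<^bsub>Aut_tree m\<^esub> C \<subseteq> G" "B <#>\<^bsub>Aut_tree m\<^esub> C \<noteq> {}"
    using set_mult_subset[OF assms(1,2)] assms(3,4) by (auto simp: set_mult_def)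
  have "index_mod i (B <#>\<^bsub>Aut_tree m\<^esub> C) \<le> index_mod i B * index_mod i C"
    using normal.coset_count_set_mult_le[OF normal_N finite_rcosets_N, of B C] assms by simp
  then have "ln (real (index_mod i (B <#>\<^bsub>Aut_tree m\<^esub> C))) \<le> ln (real (index_mod i B * index_mod i C))"
    using index_mod_pos[OF prod, of i] by (intro ln_mono) (simp_all flip: of_nat_mult)
  also have "\<dots> = ln (index_mod i B) + ln (index_mod i C)"
    using index_mod_pos[of B i] index_mod_pos[of C i] assms by (simp add: ln_mult)
  finally show ?thesis
    unfolding log_ratio_def add_divide_distrib[symmetric]
    by (rule divide_right_mono[OF _ ln_index_G_nonneg])
qed

text \<open>Indices modulo \<open>N i\<close> are submultiplicative along the product decomposition. This one inequality
bounds a dimension from above and, applied to a complement, from below.\<close>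

lemma log_ratio_rist_join_le:
  assumes "finite F" and "F \<subseteq> tree_verts m" and "pairwise (\<parallel>) F"
  shows "log_ratio i (rist_join F) \<le> (\<Sum>v\<in>F. log_ratio i (rist m G v))"
  using assms
proof (induction F)
  case empty
  have "rist_join {} = {\<one>\<^bsub>Aut_tree m\<^esub>}" by (simp add: A.generate_empty)
  then show ?case by (simp add: log_ratio_def coset_count_def)
next
  case (insert v F)
  have par: "v \<parallel> w" if "w \<in> F" for w
    using insert.prems(2) insert.hyps(2) that by (auto simp: pairwise_insert)
  have v: "v \<in> tree_verts m" using insert.prems by simp
  have ne: "rist m G v \<noteq> {}" "rist_join F \<noteq> {}"
    using subgroup.one_closed[OF subgroup_rist[OF subgroup_G v]] one_in_rist_join by auto
  have "rist_join (insert v F) \<subseteq> rist_join {v} <#>\<^bsub>Aut_tree m\<^esub> rist_join F"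
    using rist_join_Un[of "{v}" F] insert.prems par by simp
  also have "\<dots> \<subseteq> rist m G v <#>\<^bsub>Aut_tree m\<^esub> rist_join F"
    using rist_join_singleton[OF v] unfolding set_mult_def by blast
  finally have "log_ratio i (rist_join (insert v F)) \<le> log_ratio i (rist m G v <#>\<^bsub>Aut_tree m\<^esub> rist_join F)"
  proof (rule log_ratio_mono)
    show "rist m G v <#>\<^bsub>Aut_tree m\<^esub> rist_join F \<subseteq> G"
      by (rule set_mult_subset[OF rist_subset rist_join_subset])
    show "rist_join (insert v F) \<noteq> {}" using one_in_rist_join by blast
  qed
  also have "\<dots> \<le> log_ratio i (rist m G v) + log_ratio i (rist_join F)"
    using rist_subset rist_join_subset ne by (rule log_ratio_set_mult_le)
  also have "\<dots> \<le> log_ratio i (rist m G v) + (\<Sum>v\<in>F. log_ratio i (rist m G v))"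
    using insert by (auto simp: pairwise_insert)
  finally show ?case using insert.hyps by simp
qed

lemma hdim_eq_liminf_log_ratio: "B \<subseteq> G \<Longrightarrow> hdim m G N B = liminf (\<lambda>i. ereal (log_ratio i B))"
  by (simp add: hdim_eq log_ratio_def)

lemma hdim_in_unit:
  assumes "B \<subseteq> G" "B \<noteq> {}"
  shows "hdim m G N B \<in> {0..1}"
proof -
  have "0 \<le> liminf (\<lambda>i. ereal (log_ratio i B))"
    using log_ratio_nonneg[OF assms] by (intro Liminf_bounded always_eventually) auto
  moreover have "liminf (\<lambda>i. ereal (log_ratio i B)) \<le> limsup (\<lambda>i. ereal (log_ratio i B))"
    by (rule Liminf_le_Limsup) simp
  moreover have "limsup (\<lambda>i. ereal (log_ratio i B)) \<le> 1"
    using log_ratio_le_1[OF assms] by (intro Limsup_bounded always_eventually) (auto simp: one_ereal_def)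
  ultimately show ?thesis using hdim_eq_liminf_log_ratio[OF assms(1)] by auto
qed

end

section \<open>Rigid stabilizers under a nice filtration\<close>

locale nice_filtered_tree_group = filtered_tree_group +
  assumes transitive: "level_transitive m G"
    and nice: "nice_filtration m G N"
    and full: "\<forall>n\<ge>1. hdim m G N (Rist m G n) = 1"
begin

lemma level_size_pos: "level_size m n > 0"
  using m_pos by (simp add: level_size_def prod_pos)

lemma Rist_eq: "Rist m G n = rist_join (tree_level m n)"
  by (simp add: Rist_def)

lemma Rist_nonempty: "Rist m G n \<noteq> {}"
  using one_in_rist_join by (auto simp: Rist_eq)

lemma index_rist_level:
  assumes "u \<in> tree_level m n" and "v \<in> tree_level m n"
  shows "index_mod i (rist m G u) = index_mod i (rist m G v)"
proof -
  have "index_mod i (rist m G u) \<le> index_mod i (rist m G v)"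
    if uv: "u \<in> tree_level m n" "v \<in> tree_level m n" for u v
  proof -
    obtain k where k: "k \<in> G" "k u = v"
      using transitive uv unfolding level_transitive_def by blast
    show ?thesis
    proof (rule normal.coset_count_conj_le[OF normal_N finite_rcosets_N])
      show "k \<in> carrier grp" "rist m G u \<subseteq> carrier grp" "rist m G v \<subseteq> carrier grp"
        using k rist_subset by simp_all
      fix a assume "a \<in> rist m G u"
      then show "k \<otimes>\<^bsub>grp\<^esub> a \<otimes>\<^bsub>grp\<^esub> inv\<^bsub>grp\<^esub> k \<in> rist m G v"
        using rist_conj[OF subgroup_G k(1), of a u] k uv by (simp add: inv_grp tree_level_def)
    qed
  qed
  then show ?thesis using assms by (meson le_antisym)
qed

text \<open>Niceness enters through cardinalities only: for almost all \<open>i\<close> the image of the rigid level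
stabilizer has as many elements as the product of the images of the rigid vertex stabilizers, which
are equal in size by conjugacy.\<close>

lemma index_Rist:
  assumes n: "n \<ge> 1" and v: "v \<in> tree_level m n"
  shows "\<forall>\<^sub>F i in sequentially. index_mod i (Rist m G n) = index_mod i (rist m G v) ^ level_size m n"
proof -
  have "finite {i. \<not> prod_quot m (Rist m G n) (N i) \<cong>
        product_group (tree_level m n) (\<lambda>v. prod_quot m (rist m G v) (N i))}"
    using nice n by (simp add: nice_filtration_def)
  then have "\<forall>\<^sub>F i in sequentially. prod_quot m (Rist m G n) (N i) \<cong>
        product_group (tree_level m n) (\<lambda>v. prod_quot m (rist m G v) (N i))"
    by (simp add: eventually_cofinite flip: cofinite_eq_sequentially)
  then show ?thesis
  proof eventually_elim
    case (elim i)
    then obtain \<phi> where "\<phi> \<in> iso (prod_quot m (Rist m G n) (N i))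
        (product_group (tree_level m n) (\<lambda>v. prod_quot m (rist m G v) (N i)))"
      unfolding is_iso_def by blast
    then have "card (carrier (prod_quot m (Rist m G n) (N i)))
        = card (\<Pi>\<^sub>E u\<in>tree_level m n. carrier (prod_quot m (rist m G u) (N i)))"
      using bij_betw_same_card by (fastforce simp: iso_def)
    also have "\<dots> = (\<Prod>u\<in>tree_level m n. index_mod i (rist m G u))"
      using finite_tree_level by (simp add: card_PiE card_prod_quot[OF rist_subset])
    also have "\<dots> = (\<Prod>u\<in>tree_level m n. index_mod i (rist m G v))"
      by (rule prod.cong[OF refl index_rist_level[OF _ v]])
    finally show ?case
      using card_prod_quot[of "Rist m G n" i] rist_join_subset by (simp add: card_tree_level Rist_eq)
  qed
qed

text \<open>The ratios never exceed \<open>1\<close>, so a lower limit equal to \<open>1\<close> is a limit. This is why full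
dimensionality controls every index, not just a subsequence.\<close>

lemma log_ratio_Rist_tendsto:
  assumes "n \<ge> 1"
  shows "(\<lambda>i. log_ratio i (Rist m G n)) \<longlonglongrightarrow> 1"
proof -
  let ?r = "\<lambda>i. ereal (log_ratio i (Rist m G n))"
  have sub: "Rist m G n \<subseteq> G" using rist_join_subset by (simp add: Rist_eq)
  have "liminf ?r = 1"
    using full assms hdim_eq_liminf_log_ratio[OF sub] by simp
  moreover have "limsup ?r \<le> 1"
    using log_ratio_le_1[OF sub Rist_nonempty]
    by (intro Limsup_bounded always_eventually) (auto simp: one_ereal_def)
  moreover have "liminf ?r \<le> limsup ?r" by (rule Liminf_le_Limsup) simp
  ultimately have "?r \<longlonglongrightarrow> 1" by (simp add: tendsto_iff_Liminf_eq_Limsup)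
  then show ?thesis by (simp add: one_ereal_def)
qed

lemma log_ratio_rist_tendsto:
  assumes "n \<ge> 1" and v: "v \<in> tree_level m n"
  shows "(\<lambda>i. log_ratio i (rist m G v)) \<longlonglongrightarrow> 1 / level_size m n"
proof -
  have "(\<lambda>i. log_ratio i (Rist m G n) / level_size m n) \<longlonglongrightarrow> 1 / level_size m n"
    by (intro tendsto_divide log_ratio_Rist_tendsto[OF assms(1)] tendsto_const)
      (use level_size_pos in \<open>simp add: less_imp_neq[symmetric]\<close>)
  moreover have "\<forall>\<^sub>F i in sequentially. log_ratio i (Rist m G n) / level_size m n = log_ratio i (rist m G v)"
    using index_Rist[OF assms]
  proof eventually_elim
    case (elim i)
    have "v \<in> tree_verts m" using v by (simp add: tree_level_def)
    then have "rist m G v \<noteq> {}"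
      using subgroup.one_closed[OF subgroup_rist[OF subgroup_G]] by blast
    then have "index_mod i (rist m G v) \<ge> 1" by (rule index_mod_pos[OF rist_subset])
    then show ?case
      using elim level_size_pos[of n] by (simp add: log_ratio_def ln_realpow)
  qed
  ultimately show ?thesis by (rule Lim_transform_eventually)
qed

text \<open>If all vertices from level \<open>n\<close> on had a single child, then an automorphism would be determined by
its action on level \<open>n\<close>. Deep rigid stabilizers would be trivial and have dimension \<open>0\<close>.
\<close>

lemma branching_infinitely_often: "\<exists>j\<ge>n. m j \<ge> 2"
proof (rule ccontr)
  assume "\<not> (\<exists>j\<ge>n. m j \<ge> 2)"
  \<comment> \<open>Level \<open>Suc n\<close> is used because full dimensionality says nothing about level \<open>0\<close>.\<close>
  then have one: "m j = 1" if "j \<ge> Suc n" for j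
    using that m_pos by (metis One_nat_def Suc_leD Suc_leI le_antisym not_less_eq_eq numeral_2_eq_2)
  have "rist m G v \<subseteq> {\<one>\<^bsub>Aut_tree m\<^esub>}" if v: "v \<in> tree_level m (Suc n)" for v
  proof
    fix g assume g: "g \<in> rist m G v"
    then have gA: "g \<in> tree_aut m" using rist_subset G_subset by blast
    have "g u = u" if u: "u \<in> tree_verts m" for u
    proof (cases "prefix v u")
      case True
      have "prefix v (g u)"
        using tree_aut_prefix[OF gA u True] g by (simp add: rist_def)
      moreover have len: "length (g u) = length u" and gu: "g u \<in> tree_verts m"
        using gA u by (simp_all add: tree_aut_length tree_aut_in_verts)
      ultimately show ?thesis
      proof (intro nth_equalityI)
        fix j assume j: "j < length (g u)"
        show "g u ! j = u ! j"
        proof (cases "j < length v")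
          case True
          then show ?thesis using \<open>prefix v u\<close> \<open>prefix v (g u)\<close> by (metis prefix_def nth_append)
        next
          case False
          then have "m j = 1" using one v by (simp add: tree_level_def)
          moreover have "g u ! j < m j" "u ! j < m j"
            using j gu u len by (simp_all add: tree_verts_def)
          ultimately show ?thesis by simp
        qed
      qed simp
    qed (use g u in \<open>simp add: rist_def\<close>)
    then show "g \<in> {\<one>\<^bsub>Aut_tree m\<^esub>}" using gA by (auto intro: tree_aut_eqI)
  qed
  then have "rist_join (tree_level m (Suc n)) \<subseteq> {\<one>\<^bsub>Aut_tree m\<^esub>}"
    by (intro A.generate_subgroup_incl A.triv_subgroup) blast
  then have "Rist m G (Suc n) = {\<one>\<^bsub>Aut_tree m\<^esub>}"
    using Rist_nonempty[of "Suc n"] by (simp add: Rist_eq subset_singleton_iff)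
  then have "log_ratio i (Rist m G (Suc n)) = 0" for i
    by (simp add: log_ratio_def coset_count_def)
  then show False using log_ratio_Rist_tendsto[of "Suc n"] by (simp add: LIMSEQ_const_iff)
qed

lemma level_size_unbounded: "\<exists>k\<ge>1. level_size m k \<ge> b"
proof (induction b)
  case 0
  then show ?case by auto
next
  case (Suc b)
  then obtain k where k: "k \<ge> 1" "level_size m k \<ge> b" by blast
  \<comment> \<open>The size at least doubles from level \<open>j\<close> to level \<open>Suc j\<close>.\<close>
  obtain j where j: "j \<ge> k" "m j \<ge> 2" using branching_infinitely_often by blast
  have "level_size m k dvd level_size m j"
    unfolding level_size_def by (rule prod_dvd_prod_subset) (use j in auto)
  then have "level_size m k \<le> level_size m j" using level_size_pos by (simp add: dvd_imp_le)
  then have "Suc b \<le> level_size m j * 2" using k level_size_pos[of j] by linarith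
  also have "\<dots> \<le> level_size m (Suc j)" using j by (simp add: level_size_def)
  finally show ?case using j k by (intro exI[of _ "Suc j"]) simp
qed

lemma small_level_weight:
  assumes "e > 0"
  shows "\<exists>k\<ge>1. 1 / real (level_size m k) < e"
proof -
  obtain b :: nat where b: "1 / e < b" using reals_Archimedean2 by blast
  obtain k where k: "k \<ge> 1" "level_size m k \<ge> b" using level_size_unbounded by blast
  have "1 / e < level_size m k" using b k(2) by linarith
  then have "1 / real (level_size m k) < e"
    using assms level_size_pos[of k] by (simp add: field_simps)
  then show ?thesis using k by blast
qed

end

section \<open>Branching off a ray\<close>

lemma parallel_if_nth_neq:
  assumes "j < length v" and "j < length w" and "v ! j \<noteq> w ! j"
  shows "v \<parallel> w"
  using assms by (auto simp: parallel_def prefix_def nth_append)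

text \<open>The subtrees branching off the infinite path \<open>d 0, d 1, \<dots>\<close> partition the boundary of the tree
without the end of this path. Choosing a set \<open>D j\<close> of directions at each of its vertices selects
some of them, such as those to the left or to the right of the path.\<close>

definition ray :: "(nat \<Rightarrow> nat) \<Rightarrow> nat \<Rightarrow> nat list" where
  "ray d k = map d [0..<k]"

definition branches :: "(nat \<Rightarrow> nat) \<Rightarrow> (nat \<Rightarrow> nat set) \<Rightarrow> nat \<Rightarrow> nat list set" where
  "branches d D k = (\<Union>j<k. (\<lambda>x. ray d j @ [x]) ` D j)"

lemma length_ray [simp]: "length (ray d k) = k"
  by (simp add: ray_def)

lemma nth_ray [simp]: "j < k \<Longrightarrow> ray d k ! j = d j"
  by (simp add: ray_def)

lemma prefix_ray: "j \<le> k \<Longrightarrow> prefix (ray d j) (ray d k)"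
  by (metis ray_def less_eqE map_append prefixI upt_add_eq_append zero_le)

lemma ray_inject [simp]: "ray d j = ray d k \<longleftrightarrow> j = k"
  by (metis length_ray)

lemma ray_notin_branches:
  assumes D: "\<And>j. d j \<notin> D j"
  shows "ray d k \<notin> branches d D k"
proof
  assume "ray d k \<in> branches d D k"
  then obtain j x where jx: "j < k" "x \<in> D j" "ray d k = ray d j @ [x]"
    by (auto simp: branches_def)
  then have "k = Suc j" by (metis length_append_singleton length_ray)
  then have "d j = x" using jx by (metis lessI length_ray nth_append_length nth_ray)
  then show False using jx D by blast
qed

lemma branches_parallel:
  assumes D: "\<And>j. d j \<notin> D j"
  shows "pairwise (\<parallel>) (insert (ray d k) (branches d D k))"
proof -
  have ray: "ray d k \<parallel> ray d j @ [x]" if "j < k" "x \<in> D j" for j x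
    using that D[of j] by (intro parallel_if_nth_neq[of j]) (auto simp: nth_append)
  have "ray d i @ [x] \<parallel> ray d j @ [y]" if "i \<le> j" "x \<in> D i" "y \<in> D j" "i = j \<longrightarrow> x \<noteq> y" for i j x y
    using that D[of i] by (intro parallel_if_nth_neq[of i]) (auto simp: nth_append)
  then have "ray d i @ [x] \<parallel> ray d j @ [y]"
    if "x \<in> D i" "y \<in> D j" "ray d i @ [x] \<noteq> ray d j @ [y]" for i j x y
    using that by (metis nat_le_linear parallel_commute)
  then show ?thesis
    using ray unfolding pairwise_insert
    by (auto simp: branches_def pairwise_def parallel_commute)
qed

text \<open>All vertices that branch off at level \<open>j\<close> have length \<open>Suc j\<close>, whence the weight \<open>g (Suc j)\<close>.\<close>

lemma sum_branches:
  fixes f :: "nat list \<Rightarrow> real"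
  assumes D: "\<And>j. d j \<notin> D j" and fin: "\<And>j. finite (D j)"
    and f: "\<And>v. f v = g (length v)"
  shows "(\<Sum>v\<in>insert (ray d k) (branches d D k). f v) = g k + (\<Sum>j<k. real (card (D j)) * (g (Suc j) :: real))"
proof -
  have "ray d k \<notin> branches d D k" by (rule ray_notin_branches[OF D])
  moreover have "finite (branches d D k)" using fin by (simp add: branches_def)
  moreover have "(\<Sum>v\<in>branches d D k. f v) = (\<Sum>j<k. real (card (D j)) * g (Suc j))"
  proof -
    have "(\<Sum>v\<in>branches d D k. f v) = (\<Sum>j<k. \<Sum>v\<in>(\<lambda>x. ray d j @ [x]) ` D j. f v)"
      unfolding branches_def
    proof (rule sum.UNION_disjoint)
      show "\<forall>i\<in>{..<k}. \<forall>j\<in>{..<k}. i \<noteq> j \<longrightarrow>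
          (\<lambda>x. ray d i @ [x]) ` D i \<inter> (\<lambda>x. ray d j @ [x]) ` D j = {}"
        by (auto dest: arg_cong[of _ _ length])
    qed (use fin in auto)
    also have "\<dots> = (\<Sum>j<k. real (card (D j)) * g (Suc j))"
    proof (rule sum.cong[OF refl])
      fix j
      have "(\<Sum>v\<in>(\<lambda>x. ray d j @ [x]) ` D j. f v) = (\<Sum>x\<in>D j. f (ray d j @ [x]))"
        by (subst sum.reindex) (auto simp: inj_on_def)
      then show "(\<Sum>v\<in>(\<lambda>x. ray d j @ [x]) ` D j. f v) = real (card (D j)) * g (Suc j)"
        by (simp add: f)
    qed
    finally show ?thesis .
  qed
  ultimately show ?thesis by (simp add: f)
qed

section \<open>Mixed radix digits\<close>

text \<open>The fractional digits of \<open>\<alpha>\<close> in the mixed radix system with bases \<open>m 0, m 1, \<dots>\<close>, which are the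
increments between consecutive truncations.\<close>

definition mixed_radix_digit :: "(nat \<Rightarrow> nat) \<Rightarrow> real \<Rightarrow> nat \<Rightarrow> nat" where
  "mixed_radix_digit m \<alpha> j =
     nat (\<lfloor>\<alpha> * level_size m (Suc j)\<rfloor> - int (m j) * \<lfloor>\<alpha> * level_size m j\<rfloor>)"

lemma int_mixed_radix_digit:
  "int (mixed_radix_digit m \<alpha> j) = \<lfloor>\<alpha> * level_size m (Suc j)\<rfloor> - int (m j) * \<lfloor>\<alpha> * level_size m j\<rfloor>"
proof -
  have "real (m j) * \<lfloor>\<alpha> * level_size m j\<rfloor> \<le> real (m j) * (\<alpha> * level_size m j)"
    by (intro mult_left_mono) auto
  also have "\<dots> = \<alpha> * level_size m (Suc j)" by (simp add: level_size_def)
  finally have "int (m j) * \<lfloor>\<alpha> * level_size m j\<rfloor> \<le> \<lfloor>\<alpha> * level_size m (Suc j)\<rfloor>"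
    by (simp add: le_floor_iff)
  then show ?thesis by (simp add: mixed_radix_digit_def)
qed

lemma mixed_radix_digit_less:
  assumes "m j > 0"
  shows "mixed_radix_digit m \<alpha> j < m j"
proof -
  have "\<alpha> * level_size m (Suc j) = real (m j) * (\<alpha> * level_size m j)" by (simp add: level_size_def)
  also have "\<dots> < real (m j) * (\<lfloor>\<alpha> * level_size m j\<rfloor> + 1)"
    using assms by (intro mult_strict_left_mono) auto
  finally have "\<lfloor>\<alpha> * level_size m (Suc j)\<rfloor> < int (m j) * (\<lfloor>\<alpha> * level_size m j\<rfloor> + 1)"
    by (simp add: floor_less_iff)
  then have "int (mixed_radix_digit m \<alpha> j) < int (m j)"
    by (simp add: int_mixed_radix_digit algebra_simps)
  then show ?thesis by simp
qed

lemma sum_mixed_radix_digits: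
  fixes \<alpha> :: real
  assumes m: "\<forall>i. m i > 0" and "0 \<le> \<alpha>" "\<alpha> < 1"
  shows "(\<Sum>j<k. mixed_radix_digit m \<alpha> j / level_size m (Suc j)) = \<lfloor>\<alpha> * level_size m k\<rfloor> / level_size m k"
proof (induction k)
  case 0
  then show ?case using assms by (simp add: level_size_def floor_eq_iff)
next
  case (Suc k)
  have pos: "real (level_size m k) > 0" "real (m k) > 0"
    using m by (simp_all add: level_size_def prod_pos)
  have "real (mixed_radix_digit m \<alpha> k) = \<lfloor>\<alpha> * level_size m (Suc k)\<rfloor> - m k * \<lfloor>\<alpha> * level_size m k\<rfloor>"
    using arg_cong[OF int_mixed_radix_digit[of m \<alpha> k], of real_of_int] by simp
  moreover have "real (level_size m (Suc k)) = level_size m k * m k" by (simp add: level_size_def)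
  ultimately show ?case using Suc.IH pos by (simp add: field_simps)
qed

section \<open>The Hausdorff spectrum\<close>

context nice_filtered_tree_group
begin

text \<open>Identify the boundary of the tree with the unit interval, so that a vertex of level \<open>k\<close> covers an
interval of length \<open>1 / level_size m k\<close>, which is also the dimension of its rigid stabilizer. The
digits of \<open>\<alpha>\<close> describe the ray ending at \<open>\<alpha>\<close>, and \<open>H\<close> is the join of the rigid stabilizers of the
vertices that branch off to its left, which cover \<open>[0, \<alpha>)\<close>. Modulo \<open>N i\<close> the group \<open>H\<close> is
controlled from level \<open>k\<close> with an error coming from the single vertex \<open>ray d k\<close>. The upper bound
replaces everything below this vertex by its rigid stabilizer. The lower bound compares with
\<open>Rist m G k\<close>: the vertices to the right and \<open>ray d k\<close> account for at most \<open>1 - a k\<close> of its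
dimension \<open>1\<close>, so \<open>H\<close> must supply the rest, where \<open>a k\<close> is the truncation of \<open>\<alpha>\<close> at level \<open>k\<close>.\<close>

lemma ex_subgroup_log_ratio_tendsto:
  assumes \<alpha>: "0 \<le> \<alpha>" "\<alpha> < 1"
  shows "\<exists>H. subgroup H grp \<and> (\<lambda>i. log_ratio i H) \<longlonglongrightarrow> \<alpha>"
proof -
  let ?W = "level_size m"
  define d where "d = mixed_radix_digit m \<alpha>"
  define L where "L j = {..<d j}" for j
  define R where "R j = {d j<..<m j}" for j
  define H where "H = rist_join (\<Union>k. branches d L k)"
  define a where "a k = \<lfloor>\<alpha> * ?W k\<rfloor> / ?W k" for k
  have dm: "d j < m j" for j using mixed_radix_digit_less m_pos by (simp add: d_def)
  have notin: "d j \<notin> L j" "d j \<notin> R j" and fin: "finite (L j)" "finite (R j)"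
    and sub: "L j \<subseteq> {..<m j}" "R j \<subseteq> {..<m j}" for j
    using dm[of j] by (auto simp: L_def R_def)
  have ray: "ray d k \<in> tree_level m k" for k
    using dm by (simp add: tree_level_def tree_verts_def)
  have branch: "v \<in> tree_level m (length v) \<and> length v \<ge> 1"
    if "v \<in> branches d D k" "\<And>j. D j \<subseteq> {..<m j}" for v D k
    using that ray by (fastforce simp: branches_def tree_level_def snoc_in_tree_verts_iff)
  have verts: "insert (ray d k) (branches d D k) \<subseteq> tree_verts m"
    if "\<And>j. D j \<subseteq> {..<m j}" for D k
    using ray[of k] branch[OF _ that] by (auto simp: tree_level_def)
  have join_le: "log_ratio i (rist_join (insert (ray d k) (branches d D k)))
      \<le> (\<Sum>v\<in>insert (ray d k) (branches d D k). log_ratio i (rist m G v))"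
    if "\<And>j. d j \<notin> D j" "\<And>j. finite (D j)" "\<And>j. D j \<subseteq> {..<m j}" for D k i
  proof (rule log_ratio_rist_join_le)
    show "finite (insert (ray d k) (branches d D k))" using that(2) by (simp add: branches_def)
  qed (intro verts branches_parallel that)+
  have lim: "(\<lambda>i. \<Sum>v\<in>insert (ray d k) (branches d D k). log_ratio i (rist m G v))
      \<longlonglongrightarrow> 1 / ?W k + (\<Sum>j<k. card (D j) * (1 / ?W (Suc j)))"
    if "\<And>j. d j \<notin> D j" "\<And>j. finite (D j)" "\<And>j. D j \<subseteq> {..<m j}" "k \<ge> 1" for D k
  proof -
    have "(\<lambda>i. \<Sum>v\<in>insert (ray d k) (branches d D k). log_ratio i (rist m G v))
        \<longlonglongrightarrow> (\<Sum>v\<in>insert (ray d k) (branches d D k). 1 / ?W (length v))"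
      using branch[OF _ that(3)] ray[of k] that(4)
      by (intro tendsto_sum log_ratio_rist_tendsto) auto
    then show ?thesis
      using sum_branches[of d D "\<lambda>v. 1 / ?W (length v)" "\<lambda>n. 1 / ?W n" k, OF that(1,2) refl]
      by simp
  qed
  have ne: "rist_join F \<noteq> {}" for F using one_in_rist_join by blast
  have upper: "log_ratio i H \<le> (\<Sum>v\<in>insert (ray d k) (branches d L k). log_ratio i (rist m G v))" for i k
  proof -
    have "\<exists>w\<in>insert (ray d k) (branches d L k). prefix w v" if v: "v \<in> (\<Union>k. branches d L k)" for v
    proof -
      obtain j x where jx: "v = ray d j @ [x]" "x \<in> L j"
        using v by (auto simp: branches_def)
      show ?thesis
      proof (cases "j < k")
        case True
        then have "v \<in> branches d L k" using jx by (auto simp: branches_def)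
        then show ?thesis by blast
      next
        case False
        then have "prefix (ray d k) v" using jx prefix_ray[of k j d] by simp
        then show ?thesis by blast
      qed
    qed
    then have "H \<subseteq> rist_join (insert (ray d k) (branches d L k))"
      unfolding H_def using verts[OF sub(1)] by (intro rist_join_leI) auto
    then have "log_ratio i H \<le> log_ratio i (rist_join (insert (ray d k) (branches d L k)))"
      using rist_join_subset ne unfolding H_def by (rule log_ratio_mono)
    also have "\<dots> \<le> (\<Sum>v\<in>insert (ray d k) (branches d L k). log_ratio i (rist m G v))"
      by (rule join_le) (use notin fin sub in auto)
    finally show ?thesis .
  qed
  have lower: "log_ratio i (Rist m G k)
      \<le> log_ratio i H + (\<Sum>v\<in>insert (ray d k) (branches d R k). log_ratio i (rist m G v))" for i k
  proof -
    let ?E = "branches d L k" and ?F = "insert (ray d k) (branches d R k)"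
    have "\<exists>w\<in>?E \<union> ?F. prefix w v" if v: "v \<in> tree_level m k" for v
    proof (cases "v = ray d k")
      case False
      have len: "length v = k" using v by (simp add: tree_level_def)
      then have ex: "\<exists>j<k. v ! j \<noteq> d j" using False by (metis length_ray nth_equalityI nth_ray)
      \<comment> \<open>The vertex leaves the ray at the first place where it differs from it.\<close>
      define j where "j = (LEAST j. j < k \<and> v ! j \<noteq> d j)"
      have j: "j < k" "v ! j \<noteq> d j" using LeastI_ex[OF ex] by (simp_all add: j_def)
      have before: "v ! i = d i" if "i < j" for i
        using not_less_Least[of i "\<lambda>j. j < k \<and> v ! j \<noteq> d j"] that j(1) by (simp add: j_def)
      have "take j v = ray d j"
        using before j(1) len by (intro nth_equalityI) auto
      then have pre: "prefix (ray d j @ [v ! j]) v"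
        using j(1) len take_Suc_conv_app_nth[of j v] by (metis take_is_prefix)
      have "v ! j < m j" using v j(1) by (simp add: tree_level_def tree_verts_def)
      then have "v ! j \<in> L j \<or> v ! j \<in> R j" using j(2) by (auto simp: L_def R_def)
      then have "ray d j @ [v ! j] \<in> ?E \<union> ?F" using j(1) by (auto simp: branches_def)
      then show ?thesis using pre by blast
    qed simp
    then have "Rist m G k \<subseteq> rist_join (?E \<union> ?F)"
      unfolding Rist_eq using verts[OF sub(1), of k] verts[OF sub(2), of k]
      by (intro rist_join_leI) blast+
    also have "\<dots> \<subseteq> rist_join ?E <#>\<^bsub>Aut_tree m\<^esub> rist_join ?F"
    proof (rule rist_join_Un)
      have par: "pairwise (\<parallel>) (insert (ray d k) (branches d (\<lambda>j. L j \<union> R j) k))"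
        by (rule branches_parallel) (use notin in auto)
      have Un: "branches d (\<lambda>j. L j \<union> R j) k = ?E \<union> branches d R k"
        by (auto simp: branches_def)
      have "x \<notin> R i" if "x \<in> L i" for x i using that by (simp add: L_def R_def)
      then have "?E \<inter> branches d R k = {}"
        by (auto simp: branches_def)
      then have "v \<noteq> w" if "v \<in> ?E" "w \<in> ?F" for v w
        using that ray_notin_branches[of d L k, OF notin(1)] by blast
      then show "v \<parallel> w" if "v \<in> ?E" "w \<in> ?F" for v w
        using par that unfolding Un by (auto simp: pairwise_def)
    qed (use verts sub in auto)
    finally have "log_ratio i (Rist m G k) \<le> log_ratio i (rist_join ?E <#>\<^bsub>Aut_tree m\<^esub> rist_join ?F)"
      using set_mult_subset[OF rist_join_subset rist_join_subset] Rist_nonempty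
      by (rule log_ratio_mono)
    also have "\<dots> \<le> log_ratio i (rist_join ?E) + log_ratio i (rist_join ?F)"
      using rist_join_subset rist_join_subset ne ne by (rule log_ratio_set_mult_le)
    also have "log_ratio i (rist_join ?E) \<le> log_ratio i H"
    proof (rule log_ratio_mono[OF _ _ ne])
      show "rist_join ?E \<subseteq> H" unfolding H_def by (intro A.mono_generate) blast
      show "H \<subseteq> G" unfolding H_def by (rule rist_join_subset)
    qed
    also have "log_ratio i (rist_join ?F) \<le> (\<Sum>v\<in>?F. log_ratio i (rist m G v))"
      by (rule join_le) (use notin fin sub in auto)
    finally show ?thesis by simp
  qed
  have a: "(\<Sum>j<k. card (L j) * (1 / ?W (Suc j))) = a k" for k
    using sum_mixed_radix_digits[OF m_pos \<alpha>] by (simp add: L_def d_def a_def)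
  \<comment> \<open>Per level, the left, right and central children share the weight of \<open>ray d j\<close>; the sum telescopes.\<close>
  have b: "1 / ?W k + (\<Sum>j<k. card (R j) * (1 / ?W (Suc j))) = 1 - a k" for k
  proof -
    have "card (R j) * (1 / ?W (Suc j)) = 1 / ?W j - 1 / ?W (Suc j) - card (L j) * (1 / ?W (Suc j))" for j
    proof -
      have card: "real (card (R j)) = real (m j) - 1 - real (card (L j))"
        using dm[of j] by (simp add: L_def R_def of_nat_diff)
      have "real (?W (Suc j)) = ?W j * m j" by (simp add: level_size_def)
      then have weight: "1 / real (?W j) = m j / ?W (Suc j)"
        using m_pos[rule_format, of j] by simp
      show ?thesis unfolding card weight by (simp add: diff_divide_distrib)
    qed
    then have "(\<Sum>j<k. card (R j) * (1 / ?W (Suc j))) = (\<Sum>j<k. 1 / ?W j - 1 / ?W (Suc j)) - a k"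
      by (simp add: sum_subtractf flip: a)
    also have "(\<Sum>j<k. 1 / real (?W j) - 1 / ?W (Suc j)) = 1 - 1 / ?W k"
      by (subst sum_lessThan_telescope') (simp add: level_size_def)
    finally show ?thesis by simp
  qed
  have a_le: "a k \<le> \<alpha>" and a_gt: "\<alpha> < a k + 1 / ?W k" for k
  proof -
    have W: "real (?W k) > 0" using level_size_pos by simp
    show "a k \<le> \<alpha>" using W by (simp add: a_def divide_le_eq)
    have "\<alpha> * ?W k < \<lfloor>\<alpha> * ?W k\<rfloor> + 1" by linarith
    then show "\<alpha> < a k + 1 / ?W k" using W by (simp add: a_def field_simps)
  qed
  have "(\<lambda>i. log_ratio i H) \<longlonglongrightarrow> \<alpha>"
  proof (rule order_tendstoI)
    fix y assume "y < \<alpha>"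
    \<comment> \<open>A level so deep that truncating \<open>\<alpha>\<close> there still leaves a value above \<open>y\<close>.\<close>
    then obtain k where k: "k \<ge> 1" "1 / real (?W k) < \<alpha> - y" using small_level_weight[of "\<alpha> - y"] by auto
    have "(\<lambda>i. log_ratio i (Rist m G k) - (\<Sum>v\<in>insert (ray d k) (branches d R k). log_ratio i (rist m G v)))
        \<longlonglongrightarrow> 1 - (1 / ?W k + (\<Sum>j<k. card (R j) * (1 / ?W (Suc j))))"
      using notin fin sub k(1) by (intro tendsto_diff log_ratio_Rist_tendsto lim) auto
    then have "(\<lambda>i. log_ratio i (Rist m G k) - (\<Sum>v\<in>insert (ray d k) (branches d R k). log_ratio i (rist m G v)))
        \<longlonglongrightarrow> a k" by (simp only: b) simp
    moreover have "y < a k" using k(2) a_gt[of k] by linarith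
    ultimately have "\<forall>\<^sub>F i in sequentially. y < log_ratio i (Rist m G k) -
        (\<Sum>v\<in>insert (ray d k) (branches d R k). log_ratio i (rist m G v))"
      by (rule order_tendstoD(1))
    then show "\<forall>\<^sub>F i in sequentially. y < log_ratio i H"
      by eventually_elim (use lower[of _ k] in \<open>smt (verit)\<close>)
  next
    fix y assume "\<alpha> < y"
    then obtain k where k: "k \<ge> 1" "1 / real (?W k) < y - \<alpha>" using small_level_weight[of "y - \<alpha>"] by auto
    have "(\<lambda>i. \<Sum>v\<in>insert (ray d k) (branches d L k). log_ratio i (rist m G v)) \<longlonglongrightarrow> 1 / ?W k + a k"
      unfolding a[symmetric] using notin fin sub k(1) by (intro lim) auto
    moreover have "1 / ?W k + a k < y" using k(2) a_le[of k] by linarith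
    ultimately have "\<forall>\<^sub>F i in sequentially.
        (\<Sum>v\<in>insert (ray d k) (branches d L k). log_ratio i (rist m G v)) < y"
      by (rule order_tendstoD(2))
    then show "\<forall>\<^sub>F i in sequentially. log_ratio i H < y"
      by eventually_elim (use upper[of _ k] in \<open>smt (verit)\<close>)
  qed
  moreover have "subgroup H grp"
    unfolding H_def by (rule A.subgroup_incl[OF subgroup_rist_join subgroup_G rist_join_subset])
  ultimately show ?thesis by blast
qed

lemma hspec_eq: "hspec m G N = {0..1}"
proof
  show "hspec m G N \<subseteq> {0..1}"
  proof
    fix x assume "x \<in> hspec m G N"
    then obtain H where H: "x = hdim m G N H" "subgroup H grp" unfolding hspec_def by blast
    have "H \<subseteq> G" using subgroup.subset[OF H(2)] by simp
    moreover have "H \<noteq> {}" using subgroup.one_closed[OF H(2)] by blast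
    ultimately show "x \<in> {0..1}" unfolding H(1) by (rule hdim_in_unit)
  qed
  have "\<exists>H. subgroup H grp \<and> hdim m G N H = x" if x: "x \<in> {0..1}" for x
  proof (cases "x = 1")
    case True
    have "subgroup (Rist m G 1) grp"
      unfolding Rist_eq by (rule A.subgroup_incl[OF subgroup_rist_join subgroup_G rist_join_subset])
    then show ?thesis using full True by auto
  next
    case False
    then obtain \<alpha> where \<alpha>: "x = ereal \<alpha>" "0 \<le> \<alpha>" "\<alpha> < 1"
      using x by (cases x) auto
    then obtain H where H: "subgroup H grp" "(\<lambda>i. log_ratio i H) \<longlonglongrightarrow> \<alpha>"
      using ex_subgroup_log_ratio_tendsto by blast
    have "hdim m G N H = liminf (\<lambda>i. ereal (log_ratio i H))"
      using subgroup.subset[OF H(1)] by (intro hdim_eq_liminf_log_ratio) simp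
    also have "\<dots> = x"
      unfolding \<alpha>(1) using H(2) by (intro lim_imp_Liminf) auto
    finally show ?thesis using H(1) by blast
  qed
  then have "\<exists>K. subgroup K grp \<and> closedin (subtopology (congruence_topology m) G) K \<and> hdim m G N K = x"
    if "x \<in> {0..1}" for x
    using that ex_closed_subgroup_same_hdim by metis
  then show "{0..1} \<subseteq> hspec m G N"
    unfolding hspec_def by blast
qed

end

theorem theorem1:
  fixes m :: "nat \<Rightarrow> nat"
    and G :: "(nat list \<Rightarrow> nat list) set"
    and N :: "nat \<Rightarrow> (nat list \<Rightarrow> nat list) set"
  assumes "\<forall>i. m i > 0"
    and "subgroup G (Aut_tree m)"
    and "closedin (congruence_topology m) G"
    and "level_transitive m G"
    and "nice_filtration m G N"
    and "\<forall>n\<ge>1. hdim m G N (Rist m G n) = 1"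
  shows "hspec m G N = {0..1}"
proof -
  interpret nice_filtered_tree_group m G N
    using assms nice_filtration_def[of m G N]
    by (intro nice_filtered_tree_group.intro filtered_tree_group.intro
        nice_filtered_tree_group_axioms.intro) blast+
  show ?thesis by (rule hspec_eq)
qed

end
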